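(* Let $g:\mathbb{R}^+\to\mathbb{R}$ be a measurable function satisfying the following four conditions: (i) $g$ is continuous on $\mathbb{R}^+$; (ii) $\mathbb{E}\, g^2(X_1Y_1)<\infty$; (iii) for every $t_0\in\mathbb{R}^+$ there exists a measurable function $\varphi:\mathbb{R}\to\mathbb{R}$ such that $\mathbb{E}\,\varphi(\bar X\bar Y)<\infty$ for every integer $n\ge 1$, and $|g(tx)|<\varphi(x)$ for all $t\in\mathbb{R}^+$ with $t<t_0$ and all $x\in\mathbb{R}^+$; (iv) for every $t_0\in\mathbb{R}^+$ there exists a measurable function $\psi:\mathbb{R}\to\mathbb{R}$ such that $\mathbb{E}\,\psi(\bar X\bar Y)<\infty$ for every integer $n\ge 1$, and $\left|\dfrac{g(tx)}{g(t)}\right|<\psi(x)$ for all $t>t_0$ and all $x\in\mathbb{R}^+$ (the quotient being required to be well defined, i.e. $g(t)\neq 0$ for such $t$). Let $$G_n=\sum_{i=1}^n\sum_{j=1}^n g\Big(\frac{X_i}{\bar X}\,\frac{Y_j}{\bar Y}\Big),\qquad \mu=\mathbb{E}[g(X_1Y_1)],$$ $$\eta=\mathrm{Cov}\big(g(X_1Y_1),g(X_1Y_2)\big),\qquad c=\mathrm{Cov}\big(g(X_1Y_1),X_1\big),\qquad \sigma^2=2(\eta-c^2).$$ Then, as $n\to\infty$, $$\frac{1}{n^{3/2}}\{G_n-n^2\mu\}\xrightarrow{\;d\;}\mathcal{N}(0,\sigma^2).$$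
   Context: $\mathbb{R}^+=[0,\infty)$. $X_1,X_2,\dots$ and $Y_1,Y_2,\dots$ are two sequences of exponentially distributed random variables with mean $1$, all the variables $X_i,Y_j$ being mutually independent. For each $n\ge 1$, $\bar X=\frac1n\sum_{i=1}^n X_i$ and $\bar Y=\frac1n\sum_{j=1}^n Y_j$ (both depend on $n$). By symmetry, also $\eta=\mathrm{Cov}(g(X_1Y_1),g(X_2Y_1))$ and $c=\mathrm{Cov}(g(X_1Y_1),Y_1)$. The symbol $\xrightarrow{d}$ denotes convergence in distribution, and $\mathcal{N}(0,\sigma^2)$ is the centered normal law with variance $\sigma^2$ (the point mass at $0$ if $\sigma^2=0$). *)

theory Defs
  imports "HOL-Probability.Probability"
begin

definition covariance :: "'a measure \<Rightarrow> ('a \<Rightarrow> real) \<Rightarrow> ('a \<Rightarrow> real) \<Rightarrow> real" where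
  "covariance M U V =
     (\<integral>\<omega>. (U \<omega> - (\<integral>\<omega>'. U \<omega>' \<partial>M)) * (V \<omega> - (\<integral>\<omega>'. V \<omega>' \<partial>M)) \<partial>M)"

(* The second parameter is the variance, whereas that of normal_density is the standard
   deviation. The point mass needs its own case: normal_density m 0 is not a density. *)
definition normal_law :: "real \<Rightarrow> real \<Rightarrow> real measure" where
  "normal_law m v =
     (if v = 0 then return borel m else density lborel (normal_density m (sqrt v)))"

definition sample_mean :: "(nat \<Rightarrow> 'a \<Rightarrow> real) \<Rightarrow> nat \<Rightarrow> 'a \<Rightarrow> real" where
  "sample_mean Z n \<omega> = (\<Sum>i=1..n. Z i \<omega>) / real n"

definition scaled_double_sum ::
  "(real \<Rightarrow> real) \<Rightarrow> (nat \<Rightarrow> 'a \<Rightarrow> real) \<Rightarrow> (nat \<Rightarrow> 'a \<Rightarrow> real) \<Rightarrow> nat \<Rightarrow> 'a \<Rightarrow> real" where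
  "scaled_double_sum g X Y n \<omega> =
     (\<Sum>i=1..n. \<Sum>j=1..n.
        g ((X i \<omega> / sample_mean X n \<omega>) * (Y j \<omega> / sample_mean Y n \<omega>)))"

end

theory Submission
  imports Defs
begin

text \<open>
  Let \<open>x\<^sub>i\<close> and \<open>y\<^sub>j\<close> be \<open>X\<^sub>i\<close> and \<open>Y\<^sub>j\<close> divided by their sample means, let \<open>A x = E g (x Y\<^sub>1)\<close>, and write
  \<open>g (x y) - \<mu> = (A x - \<mu>) + (A y - \<mu>) + r x y\<close>, where \<open>r\<close> integrates to zero in each argument.

  The joint density of \<open>(x\<^sub>i, x\<^sub>k)\<close> with respect to the product of two exponential laws is bounded
  and differs from 1 by \<open>O(1/n)\<close>. Hence \<open>E (\<Sum>\<^sub>i f x\<^sub>i)\<^sup>2 \<le> C n \<integral>f\<^sup>2\<close> whenever \<open>\<integral>f = 0\<close>; applying this once in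
  \<open>x\<close> and once in \<open>y\<close> gives \<open>E (\<Sum>\<^sub>i\<^sub>j r x\<^sub>i y\<^sub>j)\<^sup>2 = O(n\<^sup>2)\<close>, which is negligible.

  The function \<open>A\<close> needs no smoothness of \<open>g\<close>: a dilation of its argument becomes an exponential tilt
  of the law of \<open>Y\<^sub>1\<close>. Expanding the tilt to first order shows that
  \<open>\<Sum>\<^sub>i A x\<^sub>i\<close> is, up to \<open>o(\<surd>n)\<close> in probability, \<open>\<Sum>\<^sub>i (A X\<^sub>i - c (X\<^sub>i - 1))\<close>, whose summands have
  variance \<open>\<eta> - c\<^sup>2\<close>. The central limit theorem for i.i.d. sums finishes the proof.
\<close>

section \<open>Normalized exponential samples\<close>

text \<open>The normalized variables are dependent, and \<open>g\<close> may be too rough for a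
  Taylor expansion in the sample means. The sum of \<open>r\<close> is therefore not compared with a
  sum over the raw variables but estimated under the law of the normalized sample itself. Second
  moments involve two indices at a time, so the law of one pair suffices. It is the law of n times
  two coordinates of a uniform random point of the simplex: the total of an exponential sample is
  independent of the proportions, and integrating it out leaves the Lebesgue density (n-1)(n-2)/n^2
  (1-(u+v)/n)^(n-3). The limiting variance has a geometric origin. Dividing by the sample mean
  removes the direction x - 1. Since X has variance 1 and A X has covariance c with X, the function
  A x - \<mu> - c (x - 1) is the residual of the L2 projection of A - \<mu> onto x - 1, and \<eta>
  is the variance of A X because X_1 Y_1 and X_1 Y_2 are conditionally independent given X_1. The
  X-part and the Y-part contribute equally and independently, hence the factor 2.\<close>

definition exp_law :: "real measure" where
  "exp_law = density lborel (exponential_density 1)"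

lemma sets_exp_law [simp, measurable_cong]: "sets exp_law = sets borel"
  by (simp add: exp_law_def)

lemma space_exp_law [simp]: "space exp_law = UNIV"
  by (simp add: exp_law_def)

interpretation exp_law: prob_space exp_law
  unfolding exp_law_def by (rule prob_space_exponential_density) simp

interpretation exp_law2: pair_prob_space exp_law exp_law ..

lemma nn_integral_exp_law:
  assumes "f \<in> borel_measurable borel"
  shows "(\<integral>\<^sup>+x. f x \<partial>exp_law) = (\<integral>\<^sup>+x. ennreal (exponential_density 1 x) * f x \<partial>lborel)"
  unfolding exp_law_def using assms by (subst nn_integral_density) auto

lemma AE_exp_law_pos: "AE x in exp_law. 0 < x"
  unfolding exp_law_def using AE_lborel_singleton[of 0]
  by (subst AE_density) (auto simp: exponential_density_def)

definition normalized :: "(nat \<Rightarrow> 'a \<Rightarrow> real) \<Rightarrow> nat \<Rightarrow> nat \<Rightarrow> 'a \<Rightarrow> real" where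
  "normalized X n i \<omega> = X i \<omega> / sample_mean X n \<omega>"

text \<open>
  The density is relative to \<^term>\<open>exp_law \<Otimes>\<^sub>M exp_law\<close>, not to Lebesgue measure, hence the factor
  \<^term>\<open>exp (u + v)\<close>.
\<close>

definition normalized_density :: "nat \<Rightarrow> real \<Rightarrow> real \<Rightarrow> real" where
  "normalized_density n u v =
     (if u + v \<le> n then (n - 1) * (n - 2) / n\<^sup>2 * (1 - (u + v) / n) ^ (n - 3) * exp (u + v) else 0)"

lemma measurable_normalized_density [measurable]:
  "(\<lambda>(u, v). normalized_density n u v) \<in> borel_measurable (borel \<Otimes>\<^sub>M borel)"
  unfolding normalized_density_def by measurable

text \<open>Functions of disjoint blocks of an independent family are independent. Stated as a
  product law, this feeds directly into Fubini; choosing \<open>f\<close> and \<open>g\<close> as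
  coordinate projections, sums or normalizations yields every joint law used below.\<close>

lemma (in prob_space) indep_vars_distr_pair:
  assumes ind: "indep_vars M' X I" and AB: "A \<inter> B = {}" "A \<subseteq> I" "B \<subseteq> I"
    and f [measurable]: "f \<in> measurable (PiM A M') S" and g [measurable]: "g \<in> measurable (PiM B M') T"
  shows "distr M (S \<Otimes>\<^sub>M T) (\<lambda>\<omega>. (f (\<lambda>i\<in>A. X i \<omega>), g (\<lambda>i\<in>B. X i \<omega>))) =
    distr M S (\<lambda>\<omega>. f (\<lambda>i\<in>A. X i \<omega>)) \<Otimes>\<^sub>M distr M T (\<lambda>\<omega>. g (\<lambda>i\<in>B. X i \<omega>))"
proof -
  let ?A = "\<lambda>\<omega>. \<lambda>i\<in>A. X i \<omega>" and ?B = "\<lambda>\<omega>. \<lambda>i\<in>B. X i \<omega>"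
  have *: "indep_var (PiM A M') ?A (PiM B M') ?B"
    by (rule indep_var_restrict[OF ind AB])
  then have [measurable]: "?A \<in> measurable M (PiM A M')" "?B \<in> measurable M (PiM B M')"
    by (auto dest: indep_var_rv1 indep_var_rv2)
  have T: "prob_space (distr (distr M (PiM B M') ?B) T g)"
    by (intro prob_space.prob_space_distr prob_space_distr) auto
  have "distr M S (\<lambda>\<omega>. f (?A \<omega>)) \<Otimes>\<^sub>M distr M T (\<lambda>\<omega>. g (?B \<omega>)) =
      distr (distr M (PiM A M') ?A) S f \<Otimes>\<^sub>M distr (distr M (PiM B M') ?B) T g"
    by (simp add: distr_distr comp_def)
  also have "\<dots> = distr (distr M (PiM A M') ?A \<Otimes>\<^sub>M distr M (PiM B M') ?B) (S \<Otimes>\<^sub>M T) (\<lambda>(x, y). (f x, g y))"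
    using T by (intro pair_measure_distr) (auto simp: prob_space_imp_sigma_finite)
  also have "\<dots> = distr (distr M (PiM A M' \<Otimes>\<^sub>M PiM B M') (\<lambda>\<omega>. (?A \<omega>, ?B \<omega>))) (S \<Otimes>\<^sub>M T) (\<lambda>(x, y). (f x, g y))"
    using * by (simp add: indep_var_distribution_eq)
  also have "\<dots> = distr M (S \<Otimes>\<^sub>M T) (\<lambda>\<omega>. (f (?A \<omega>), g (?B \<omega>)))"
    by (subst distr_distr) (auto simp: comp_def)
  finally show ?thesis ..
qed

locale exponential_sample = prob_space +
  fixes X :: "nat \<Rightarrow> 'a \<Rightarrow> real"
  assumes indep: "indep_vars (\<lambda>_. borel) X {1..}"
    and exponential: "i \<ge> 1 \<Longrightarrow> distributed M lborel (X i) (exponential_density 1)"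
begin

lemma measurable_X [measurable]: "i \<ge> 1 \<Longrightarrow> X i \<in> borel_measurable M"
  using exponential[of i] by (simp add: distributed_def)

lemma distr_X: "i \<ge> 1 \<Longrightarrow> distr M borel (X i) = exp_law"
  using exponential[of i] unfolding exp_law_def distributed_distr_eq_density[OF exponential, symmetric]
  by (intro distr_cong) auto

lemma measurable_sample_mean [measurable]: "sample_mean X n \<in> borel_measurable M"
  unfolding sample_mean_def[abs_def] by measurable

lemma measurable_normalized [measurable]: "i \<ge> 1 \<Longrightarrow> normalized X n i \<in> borel_measurable M"
  unfolding normalized_def[abs_def] by measurable

lemma nn_integral_triple:
  assumes ik: "i \<in> {1..n}" "k \<in> {1..n}" "i \<noteq> k" and n: "n \<ge> 3"
    and F: "(\<lambda>(x, y, r). F x y r) \<in> borel_measurable (borel \<Otimes>\<^sub>M borel \<Otimes>\<^sub>M borel)"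
  shows "(\<integral>\<^sup>+\<omega>. F (X i \<omega>) (X k \<omega>) (\<Sum>j\<in>{1..n}-{i,k}. X j \<omega>) \<partial>M) =
    (\<integral>\<^sup>+x. \<integral>\<^sup>+y. \<integral>\<^sup>+r. ennreal (exponential_density 1 x) * ennreal (exponential_density 1 y)
       * ennreal (erlang_density (n - 3) 1 r) * F x y r \<partial>lborel \<partial>lborel \<partial>lborel)"
proof -
  have [measurable (raw)]: "(\<lambda>z. F (a z) (b z) (c z)) \<in> borel_measurable N"
    if [measurable]: "a \<in> borel_measurable N" "b \<in> borel_measurable N" "c \<in> borel_measurable N"
    for N :: "'c measure" and a b c
    using measurable_compose[OF measurable_Pair[OF that(1) measurable_Pair[OF that(2,3)]] F] by simp
  define R where "R \<omega> = (\<Sum>j\<in>{1..n}-{i,k}. X j \<omega>)" for \<omega>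
  define E where "E = density lborel (erlang_density (n - 3) 1)"
  have [measurable]: "R \<in> borel_measurable M" unfolding R_def by measurable
  have mX [measurable]: "X i \<in> borel_measurable M" "X k \<in> borel_measurable M"
    using ik by auto
  have cardR: "card ({1..n} - {i,k}) = n - 2"
    using ik by (subst card_Diff_subset) auto
  have neR: "{1..n} - {i,k} \<noteq> {}"
    proof
    assume "{1..n} - {i,k} = {}"
    then have "card ({1..n} - {i,k}) = 0" by (metis card.empty)
    then show False using cardR n by linarith
  qed
  \<comment> \<open>A sum of m unit exponentials has density
    \<open>erlang_density (m - 1) 1\<close>. Here m = n - 2, and n \<ge> 3 guarantees that at least
    one summand is left.\<close>
  have "distributed M lborel R (erlang_density (card ({1..n} - {i,k}) - 1) 1)"
    unfolding R_def
    by (intro exponential_distributed_sum exponential indep_vars_subset[OF indep])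
       (use neR in auto)
  then have "distributed M lborel R (erlang_density (n - 3) 1)"
    unfolding cardR by (simp add: numeral_eq_Suc)
  then have dR: "distr M borel R = E"
    unfolding E_def by (subst distributed_distr_eq_density[symmetric]) (auto intro!: distr_cong)
  have sE [measurable_cong, simp]: "sets E = sets borel" by (simp add: E_def)
  interpret E: prob_space E unfolding E_def by (rule prob_space_erlang_density) simp
  \<comment> \<open>Independence of the triple is obtained in two stages: \<open>X k\<close> from
    \<open>R\<close>, and then \<open>X i\<close> from the pair formed by them.\<close>
  have i1: "indep_var borel (X k) borel R"
    unfolding R_def using ik by (intro indep_vars_sum indep_vars_subset[OF indep]) auto
  have "distr M (borel \<Otimes>\<^sub>M (borel \<Otimes>\<^sub>M borel))
     (\<lambda>\<omega>. ((\<lambda>f. f i) (\<lambda>j\<in>{i}. X j \<omega>), (\<lambda>f. (f k, \<Sum>j\<in>{1..n}-{i,k}. f j)) (\<lambda>j\<in>{1..n}-{i}. X j \<omega>))) =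
     distr M borel (\<lambda>\<omega>. (\<lambda>f. f i) (\<lambda>j\<in>{i}. X j \<omega>)) \<Otimes>\<^sub>M
     distr M (borel \<Otimes>\<^sub>M borel) (\<lambda>\<omega>. (\<lambda>f. (f k, \<Sum>j\<in>{1..n}-{i,k}. f j)) (\<lambda>j\<in>{1..n}-{i}. X j \<omega>))"
    by (rule indep_vars_distr_pair[OF indep]) (use ik in auto)
  moreover have "(\<lambda>f. f i) (\<lambda>j\<in>{i}. X j \<omega>) = X i \<omega>"
    "(\<lambda>f. (f k, \<Sum>j\<in>{1..n}-{i,k}. f j)) (\<lambda>j\<in>{1..n}-{i}. X j \<omega>) = (X k \<omega>, R \<omega>)" for \<omega>
    using ik by (auto simp: R_def intro!: sum.cong)
  ultimately have i2: "distr M (borel \<Otimes>\<^sub>M borel \<Otimes>\<^sub>M borel) (\<lambda>\<omega>. (X i \<omega>, X k \<omega>, R \<omega>)) =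
     distr M borel (X i) \<Otimes>\<^sub>M distr M (borel \<Otimes>\<^sub>M borel) (\<lambda>\<omega>. (X k \<omega>, R \<omega>))"
    by simp
  have law: "distr M (borel \<Otimes>\<^sub>M borel \<Otimes>\<^sub>M borel) (\<lambda>\<omega>. (X i \<omega>, X k \<omega>, R \<omega>)) = exp_law \<Otimes>\<^sub>M (exp_law \<Otimes>\<^sub>M E)"
    using i1 i2 ik by (simp add: indep_var_distribution_eq distr_X dR)
  interpret EE: pair_prob_space exp_law E ..
  interpret EEE: pair_prob_space exp_law "exp_law \<Otimes>\<^sub>M E" ..
  have "(\<integral>\<^sup>+\<omega>. F (X i \<omega>) (X k \<omega>) (R \<omega>) \<partial>M) = (\<integral>\<^sup>+z. (case z of (x, y, r) \<Rightarrow> F x y r) \<partial>(exp_law \<Otimes>\<^sub>M (exp_law \<Otimes>\<^sub>M E)))"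
    unfolding law[symmetric] by (subst nn_integral_distr) auto
  also have "\<dots> = (\<integral>\<^sup>+x. \<integral>\<^sup>+y. \<integral>\<^sup>+r. F x y r \<partial>E \<partial>exp_law \<partial>exp_law)"
    by (subst EE.nn_integral_fst[symmetric], simp)
       (subst E.nn_integral_fst[symmetric], auto)
  also have "\<dots> = (\<integral>\<^sup>+x. \<integral>\<^sup>+y. \<integral>\<^sup>+r. ennreal (erlang_density (n - 3) 1 r) * F x y r \<partial>lborel \<partial>exp_law \<partial>exp_law)"
    unfolding E_def by (intro nn_integral_cong nn_integral_density) auto
  also have "\<dots> = (\<integral>\<^sup>+x. \<integral>\<^sup>+y. ennreal (exponential_density 1 y) *
      (\<integral>\<^sup>+r. ennreal (erlang_density (n - 3) 1 r) * F x y r \<partial>lborel) \<partial>lborel \<partial>exp_law)"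
    by (intro nn_integral_cong nn_integral_exp_law) measurable
  also have "\<dots> = (\<integral>\<^sup>+x. ennreal (exponential_density 1 x) * (\<integral>\<^sup>+y. ennreal (exponential_density 1 y) *
      (\<integral>\<^sup>+r. ennreal (erlang_density (n - 3) 1 r) * F x y r \<partial>lborel) \<partial>lborel) \<partial>lborel)"
    by (intro nn_integral_exp_law) measurable
  also have "\<dots> = (\<integral>\<^sup>+x. \<integral>\<^sup>+y. \<integral>\<^sup>+r. ennreal (exponential_density 1 x) * ennreal (exponential_density 1 y)
       * ennreal (erlang_density (n - 3) 1 r) * F x y r \<partial>lborel \<partial>lborel \<partial>lborel)"
  proof (intro nn_integral_cong)
    fix x
    have "(\<integral>\<^sup>+y. \<integral>\<^sup>+r. ennreal (exponential_density 1 x) * ennreal (exponential_density 1 y)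
       * ennreal (erlang_density (n - 3) 1 r) * F x y r \<partial>lborel \<partial>lborel) =
      (\<integral>\<^sup>+y. ennreal (exponential_density 1 x) * (ennreal (exponential_density 1 y)
       * (\<integral>\<^sup>+r. ennreal (erlang_density (n - 3) 1 r) * F x y r \<partial>lborel)) \<partial>lborel)"
      unfolding mult.assoc by (intro nn_integral_cong) (subst nn_integral_cmult, measurable)+
    then show "ennreal (exponential_density 1 x) * (\<integral>\<^sup>+y. ennreal (exponential_density 1 y) *
      (\<integral>\<^sup>+r. ennreal (erlang_density (n - 3) 1 r) * F x y r \<partial>lborel) \<partial>lborel) =
      (\<integral>\<^sup>+y. \<integral>\<^sup>+r. ennreal (exponential_density 1 x) * ennreal (exponential_density 1 y)
       * ennreal (erlang_density (n - 3) 1 r) * F x y r \<partial>lborel \<partial>lborel)"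
      by (subst nn_integral_cmult[symmetric]) measurable
  qed
  finally show ?thesis unfolding R_def .
qed

end

section \<open>Joint density of two normalized exponential variables\<close>

lemma normalized_density_nonneg: "n \<ge> 3 \<Longrightarrow> 0 \<le> normalized_density n u v"
  by (auto simp: normalized_density_def divide_le_eq_1 intro!: mult_nonneg_nonneg divide_nonneg_nonneg zero_le_power)

text \<open>This is the change of variables x = c u, y = c v at a fixed total \<open>s\<close>,
  where c = s / n is the sample mean and the two factors \<bar>c\<bar> are the Jacobian. The
  right-hand side factors into the Erlang density of the total and a density of (u, v) free of
  \<open>s\<close>: the total and the proportions are independent.\<close>

lemma scaled_density_identity:
  assumes n: "n \<ge> 3" and s: "s \<noteq> 0" and c: "c = s / real n"
  shows "\<bar>c\<bar> * \<bar>c\<bar> * (exponential_density 1 (c * u) * exponential_density 1 (c * v)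
      * erlang_density (n - 3) 1 (s - (c * u + c * v))) =
    erlang_density (n - 1) 1 s * (exponential_density 1 u * exponential_density 1 v * normalized_density n u v)"
proof (cases "s < 0")
  case True
  then have "c < 0" using n c by (simp add: divide_less_0_iff)
  \<comment> \<open>The three arguments add up to s < 0, so one of the densities on the left
    vanishes.\<close>
  then have "c * u < 0 \<or> c * v < 0 \<or> s - (c * u + c * v) < 0"
    using True by linarith
  then show ?thesis using True by (auto simp: erlang_density_def)
next
  case False
  then have s: "s > 0" using s by simp
  then have c0: "c > 0" using n c by simp
  have *: "s - (c * u + c * v) = s * (1 - (u + v) / n)" unfolding c using n by (simp add: field_simps)
  consider "u < 0 \<or> v < 0" | "u \<ge> 0" "v \<ge> 0" "u + v > n" | "u \<ge> 0" "v \<ge> 0" "u + v \<le> n" by linarith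
  then show ?thesis
  proof cases
    case 1
    then show ?thesis using c0 by (auto simp: erlang_density_def mult_less_0_iff)
  next
    case 2
    then have "1 - (u + v) / n < 0" using n by (simp add: field_simps)
    then have "s * (1 - (u + v) / n) < 0" using s by (simp add: mult_less_0_iff)
    then show ?thesis using 2 * by (simp add: erlang_density_def normalized_density_def)
  next
    case 3
    obtain m where m: "n = m + 3" using n by (metis add.commute le_Suc_ex)
    have nn: "\<not> s * (1 - (u + v) / n) < 0" using s n 3 by (simp add: mult_less_0_iff not_less divide_le_eq_1)
    define w where "w = 1 - (u + v) / n"
    have ex: "exp (- (c * u)) * exp (- (c * v)) * exp (- (s * w)) = exp (- s)"
      using * by (simp add: w_def flip: exp_add)
    have ey: "exp (- u) * exp (- v) * exp (u + v) = 1"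
      by (simp flip: exp_add)
    have e1: "exponential_density 1 (c * u) = exp (- (c * u))"
      and e2: "exponential_density 1 (c * v) = exp (- (c * v))"
      using c0 3 by (auto simp: erlang_density_def mult_less_0_iff)
    have e3: "erlang_density (n - 3) 1 (s * (1 - (u + v) / n)) = (s * w) ^ m * exp (- (s * w)) / fact m"
      using nn m by (simp add: erlang_density_def w_def)
    have "\<bar>c\<bar> * \<bar>c\<bar> * (exponential_density 1 (c * u) * exponential_density 1 (c * v)
      * erlang_density (n - 3) 1 (s - (c * u + c * v))) =
      c\<^sup>2 * (s * w) ^ m / fact m * (exp (- (c * u)) * exp (- (c * v)) * exp (- (s * w)))"
      unfolding * e1 e2 e3 using c0 by (simp add: power2_eq_square)
    also have "\<dots> = (s / n)\<^sup>2 * (s * w) ^ m / fact m * exp (- s)"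
      unfolding ex by (simp add: c)
    also have "\<dots> = (s ^ (m + 2) * exp (- s) / fact (m + 2)) *
       ((real n - 1) * (real n - 2) / n\<^sup>2 * w ^ m * (exp (- u) * exp (- v) * exp (u + v)))"
    proof -
      \<comment> \<open>The quotient of the Erlang normalizations, (n-1)! by (n-3)!, produces the
        prefactor (n-1)(n-2); its denominator n^2 comes from the Jacobian.\<close>
      have f: "(fact (m + 2) :: real) = (real n - 1) * (real n - 2) * fact m"
        unfolding m by (simp add: algebra_simps)
      have "real n - 1 \<noteq> 0" "real n - 2 \<noteq> 0" "fact m \<noteq> (0 :: real)" using m by auto
      then show ?thesis
        unfolding ey f by (simp add: power_mult_distrib power_divide power_add power2_eq_square[of s] mult_ac)
    qed
    also have "\<dots> = erlang_density (n - 1) 1 s * (exponential_density 1 u * exponential_density 1 v * normalized_density n u v)"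
      using 3 s m by (simp add: erlang_density_def normalized_density_def w_def)
    finally show ?thesis .
  qed
qed

context exponential_sample begin

text \<open>At a fixed total the rescaled integrand splits by
  \<open>scaled_density_identity\<close>, and the Erlang density of the total integrates to 1.
  Working with nonnegative \<open>h\<close> makes all exchanges of integrals unconditional.\<close>

lemma nn_integral_normalized_pair:
  assumes ik: "i \<in> {1..n}" "k \<in> {1..n}" "i \<noteq> k" and n: "n \<ge> 3"
    and h: "(\<lambda>(x, y). h x y) \<in> borel_measurable (borel \<Otimes>\<^sub>M borel)"
  shows "(\<integral>\<^sup>+\<omega>. h (normalized X n i \<omega>) (normalized X n k \<omega>) \<partial>M) =
    (\<integral>\<^sup>+u. \<integral>\<^sup>+v. ennreal (normalized_density n u v) * h u v \<partial>exp_law \<partial>exp_law)"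
proof -
  have [measurable (raw)]: "(\<lambda>z. h (a z) (b z)) \<in> borel_measurable N"
    if [measurable]: "a \<in> borel_measurable N" "b \<in> borel_measurable N"
    for N :: "'c measure" and a b
    using measurable_compose[OF measurable_Pair[OF that] h] by simp
  have [measurable (raw)]: "(\<lambda>z. normalized_density n (a z) (b z)) \<in> borel_measurable N"
    if [measurable]: "a \<in> borel_measurable N" "b \<in> borel_measurable N"
    for N :: "'c measure" and a b
    using measurable_compose[OF measurable_Pair[OF that] measurable_normalized_density] by simp
  have dpos: "0 \<le> exponential_density 1 u * exponential_density 1 v * normalized_density n u v" for u v
    using n by (intro mult_nonneg_nonneg normalized_density_nonneg) auto
  define F where "F x y r = h (x / ((x + y + r) / n)) (y / ((x + y + r) / n))" for x y r
  define G where "G s x y = ennreal (exponential_density 1 x * exponential_density 1 y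
      * erlang_density (n - 3) 1 (s - (x + y))) * h (x / (s / n)) (y / (s / n))" for s x y
  have sm: "sample_mean X n \<omega> = (X i \<omega> + X k \<omega> + (\<Sum>j\<in>{1..n}-{i,k}. X j \<omega>)) / n" for \<omega>
  proof -
    have "(\<Sum>j=1..n. X j \<omega>) = X i \<omega> + (X k \<omega> + (\<Sum>j\<in>{1..n}-{i}-{k}. X j \<omega>))"
      using ik by (subst sum.remove[of "{1..n}" i], simp, simp) (subst sum.remove[of "{1..n}-{i}" k], auto)
    then show ?thesis by (simp add: sample_mean_def Diff_insert2[symmetric] insert_commute)
  qed
  have "(\<integral>\<^sup>+\<omega>. h (normalized X n i \<omega>) (normalized X n k \<omega>) \<partial>M) =
     (\<integral>\<^sup>+\<omega>. F (X i \<omega>) (X k \<omega>) (\<Sum>j\<in>{1..n}-{i,k}. X j \<omega>) \<partial>M)"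
    by (simp add: normalized_def sm F_def)
  also have "\<dots> = (\<integral>\<^sup>+x. \<integral>\<^sup>+y. \<integral>\<^sup>+r. ennreal (exponential_density 1 x) * ennreal (exponential_density 1 y)
       * ennreal (erlang_density (n - 3) 1 r) * F x y r \<partial>lborel \<partial>lborel \<partial>lborel)"
    by (rule nn_integral_triple[OF ik n]) (auto simp: F_def)
  also have "\<dots> = (\<integral>\<^sup>+x. \<integral>\<^sup>+y. \<integral>\<^sup>+s. G s x y \<partial>lborel \<partial>lborel \<partial>lborel)"
  proof (rule nn_integral_cong, rule nn_integral_cong)
    \<comment> \<open>The shift r = s - (x + y) introduces the total s of the sample; the two
      exchanges that follow make it the outermost variable, so that x and y can be rescaled at fixed
      s.\<close>
    fix x y :: real
    show "(\<integral>\<^sup>+r. ennreal (exponential_density 1 x) * ennreal (exponential_density 1 y)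
       * ennreal (erlang_density (n - 3) 1 r) * F x y r \<partial>lborel) = (\<integral>\<^sup>+s. G s x y \<partial>lborel)"
    proof (subst nn_integral_real_affine[where c = 1 and t = "- (x + y)"])
      have "F x y (- (x + y) + 1 * s) = h (x / (s / n)) (y / (s / n))" for s
        by (simp add: F_def)
      moreover have "- (x + y) + 1 * s = s - (x + y)" for s by simp
      ultimately have "ennreal (exponential_density 1 x) * ennreal (exponential_density 1 y)
          * ennreal (erlang_density (n - 3) 1 (- (x + y) + 1 * s)) * F x y (- (x + y) + 1 * s) = G s x y" for s
        unfolding G_def by (simp only: ennreal_mult erlang_density_nonneg mult_nonneg_nonneg zero_le_one)
      then show "ennreal \<bar>1\<bar> * (\<integral>\<^sup>+s. ennreal (exponential_density 1 x) * ennreal (exponential_density 1 y)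
          * ennreal (erlang_density (n - 3) 1 (- (x + y) + 1 * s)) * F x y (- (x + y) + 1 * s) \<partial>lborel) =
          (\<integral>\<^sup>+s. G s x y \<partial>lborel)" by simp
    qed (auto simp: F_def)
  qed
  also have "\<dots> = (\<integral>\<^sup>+x. \<integral>\<^sup>+s. \<integral>\<^sup>+y. G s x y \<partial>lborel \<partial>lborel \<partial>lborel)"
    by (intro nn_integral_cong lborel_pair.Fubini') (auto simp: G_def)
  also have "\<dots> = (\<integral>\<^sup>+s. \<integral>\<^sup>+x. \<integral>\<^sup>+y. G s x y \<partial>lborel \<partial>lborel \<partial>lborel)"
    by (intro lborel_pair.Fubini') (auto simp: G_def)
  also have "\<dots> = (\<integral>\<^sup>+s. \<integral>\<^sup>+u. \<integral>\<^sup>+v. ennreal (erlang_density (n - 1) 1 s) *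
     (ennreal (exponential_density 1 u * exponential_density 1 v * normalized_density n u v) * h u v) \<partial>lborel \<partial>lborel \<partial>lborel)"
  proof (rule nn_integral_cong_AE, rule AE_mp[OF AE_lborel_singleton[of 0] AE_I2], rule impI)
    \<comment> \<open>Only s = 0, where the rescaling degenerates, has to be excluded as a null set;
      negative s go through with \<bar>c\<bar>.\<close>
    fix s :: real assume s: "s \<noteq> 0"
    define c where "c = s / n"
    have c: "c \<noteq> 0" using s n by (simp add: c_def)
    have "(\<integral>\<^sup>+x. \<integral>\<^sup>+y. G s x y \<partial>lborel \<partial>lborel) =
       ennreal \<bar>c\<bar> * (\<integral>\<^sup>+u. \<integral>\<^sup>+y. G s (0 + c * u) y \<partial>lborel \<partial>lborel)"
      by (rule nn_integral_real_affine[OF _ c]) (auto simp: G_def)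
    also have "\<dots> = ennreal \<bar>c\<bar> * (\<integral>\<^sup>+u. ennreal \<bar>c\<bar> * (\<integral>\<^sup>+v. G s (0 + c * u) (0 + c * v) \<partial>lborel) \<partial>lborel)"
      by (intro arg_cong2[where f = "(*)"] nn_integral_cong nn_integral_real_affine[OF _ c] refl) (auto simp: G_def)
    also have "\<dots> = (\<integral>\<^sup>+u. \<integral>\<^sup>+v. ennreal \<bar>c\<bar> * (ennreal \<bar>c\<bar> * G s (c * u) (c * v)) \<partial>lborel \<partial>lborel)"
      by (simp add: nn_integral_cmult G_def)
    also have "\<dots> = (\<integral>\<^sup>+u. \<integral>\<^sup>+v. ennreal (erlang_density (n - 1) 1 s) *
     (ennreal (exponential_density 1 u * exponential_density 1 v * normalized_density n u v) * h u v) \<partial>lborel \<partial>lborel)"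
    proof (intro nn_integral_cong)
      fix u v :: real
      have "ennreal \<bar>c\<bar> * (ennreal \<bar>c\<bar> * G s (c * u) (c * v)) =
        ennreal (\<bar>c\<bar> * \<bar>c\<bar> * (exponential_density 1 (c * u) * exponential_density 1 (c * v)
          * erlang_density (n - 3) 1 (s - (c * u + c * v)))) * h (c * u / (s / n)) (c * v / (s / n))"
        unfolding G_def by (simp only: ennreal_mult'[OF abs_ge_zero] mult.assoc)
      also have "c * u / (s / n) = u" using c by (auto simp: c_def)
      also have "c * v / (s / n) = v" using c by (auto simp: c_def)
      also have "ennreal (\<bar>c\<bar> * \<bar>c\<bar> * (exponential_density 1 (c * u) * exponential_density 1 (c * v)
          * erlang_density (n - 3) 1 (s - (c * u + c * v)))) * h u v = ennreal (erlang_density (n - 1) 1 s) *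
          (ennreal (exponential_density 1 u * exponential_density 1 v * normalized_density n u v) * h u v)"
        unfolding scaled_density_identity[OF n s c_def]
        by (subst ennreal_mult'[where a = "erlang_density (n - 1) 1 s"], simp) (simp only: mult.assoc)
      finally show "ennreal \<bar>c\<bar> * (ennreal \<bar>c\<bar> * G s (c * u) (c * v)) =
        ennreal (erlang_density (n - 1) 1 s) *
          (ennreal (exponential_density 1 u * exponential_density 1 v * normalized_density n u v) * h u v)" .
    qed
    finally show "(\<integral>\<^sup>+x. \<integral>\<^sup>+y. G s x y \<partial>lborel \<partial>lborel) =
     (\<integral>\<^sup>+u. \<integral>\<^sup>+v. ennreal (erlang_density (n - 1) 1 s) *
     (ennreal (exponential_density 1 u * exponential_density 1 v * normalized_density n u v) * h u v) \<partial>lborel \<partial>lborel)" .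
  qed
  also have "\<dots> = (\<integral>\<^sup>+s. ennreal (erlang_density (n - 1) 1 s) * (\<integral>\<^sup>+u. \<integral>\<^sup>+v.
     (ennreal (exponential_density 1 u * exponential_density 1 v * normalized_density n u v) * h u v) \<partial>lborel \<partial>lborel) \<partial>lborel)"
    by (simp add: nn_integral_cmult)
  also have "\<dots> = (\<integral>\<^sup>+s. ennreal (erlang_density (n - 1) 1 s) \<partial>lborel) * (\<integral>\<^sup>+u. \<integral>\<^sup>+v.
     (ennreal (exponential_density 1 u * exponential_density 1 v * normalized_density n u v) * h u v) \<partial>lborel \<partial>lborel)"
    by (simp add: nn_integral_multc)
  also have "(\<integral>\<^sup>+s. ennreal (erlang_density (n - 1) 1 s) \<partial>lborel) = 1"
    using nn_integral_erlang_ith_moment[of 1 "n - 1" 0] by simp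
  also have "1 * (\<integral>\<^sup>+u. \<integral>\<^sup>+v.
     (ennreal (exponential_density 1 u * exponential_density 1 v * normalized_density n u v) * h u v) \<partial>lborel \<partial>lborel) =
    (\<integral>\<^sup>+u. \<integral>\<^sup>+v. ennreal (exponential_density 1 u) * (ennreal (exponential_density 1 v) *
       (ennreal (normalized_density n u v) * h u v)) \<partial>lborel \<partial>lborel)"
  proof (simp, intro nn_integral_cong)
    fix u v :: real
    show "ennreal (exponential_density 1 u * exponential_density 1 v * normalized_density n u v) * h u v =
      ennreal (exponential_density 1 u) * (ennreal (exponential_density 1 v) * (ennreal (normalized_density n u v) * h u v))"
      by (simp add: ennreal_mult' mult.assoc)
  qed
  also have "\<dots> = (\<integral>\<^sup>+u. ennreal (exponential_density 1 u) * (\<integral>\<^sup>+v. ennreal (exponential_density 1 v) *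
       (ennreal (normalized_density n u v) * h u v) \<partial>lborel) \<partial>lborel)"
    by (simp add: nn_integral_cmult)
  also have "\<dots> = (\<integral>\<^sup>+u. ennreal (exponential_density 1 u) * (\<integral>\<^sup>+v.
       (ennreal (normalized_density n u v) * h u v) \<partial>exp_law) \<partial>lborel)"
    by (subst nn_integral_exp_law) auto
  also have "\<dots> = (\<integral>\<^sup>+u. \<integral>\<^sup>+v. (ennreal (normalized_density n u v) * h u v) \<partial>exp_law \<partial>exp_law)"
    by (subst (2) nn_integral_exp_law) auto
  finally show ?thesis .
qed

end

section \<open>Bounds on the density of a normalized pair\<close>

text \<open>With s = u + v, the inequality 1 - s/n \<le> exp (-s/n) bounds the power by exp (3 s/n -
  s), so the factor exp s leaves exp (3 s/n). The 3 is the 3 of the exponent n - 3. On the support s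
  \<le> n this is at most exp 3, and exp t \<le> 1 + t exp t gives the sharper form.\<close>

lemma normalized_density_le:
  assumes n: "n \<ge> 3" and uv: "0 \<le> u" "0 \<le> v"
  shows "normalized_density n u v \<le> 1 + 3 * exp 3 * (u + v) / n" (is ?A)
    and "normalized_density n u v \<le> exp 3" (is ?B)
proof -
  define s where "s = u + v"
  have s0: "0 \<le> s" using uv by (simp add: s_def)
  have "normalized_density n u v \<le> exp (3 * s / n) \<and> s \<le> n" if sn: "s \<le> n"
  proof -
    obtain m where m: "n = m + 3" using n by (metis add.commute le_Suc_ex)
    have K: "(real n - 1) * (real n - 2) / n\<^sup>2 \<le> 1"
      using n by (simp add: field_simps power2_eq_square)
    have K0: "0 \<le> (real n - 1) * (real n - 2) / n\<^sup>2"
      using n by simp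
    have w: "0 \<le> 1 - s / n" using sn n by simp
    have "(1 - s / n) ^ (n - 3) \<le> exp (- s / n) ^ (n - 3)"
      using w exp_ge_add_one_self[of "- s / n"] by (intro power_mono) auto
    also have "\<dots> = exp (3 * s / n - s)"
      unfolding exp_of_nat_mult[symmetric] m by (simp add: field_simps)
    finally have "(1 - s / n) ^ (n - 3) * exp s \<le> exp (3 * s / n - s) * exp s"
      by (intro mult_right_mono) auto
    also have "\<dots> = exp (3 * s / n)" by (simp flip: exp_add)
    finally have F: "(1 - s / n) ^ (n - 3) * exp s \<le> exp (3 * s / n)" .
    have "normalized_density n u v = (real n - 1) * (real n - 2) / n\<^sup>2 * ((1 - s / n) ^ (n - 3) * exp s)"
      using sn by (simp add: normalized_density_def s_def)
    also have "\<dots> \<le> 1 * exp (3 * s / n)"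
      using K K0 F w by (intro mult_mono) auto
    finally show ?thesis using sn by simp
  qed
  moreover have "normalized_density n u v = 0" if "\<not> s \<le> n"
    using that by (simp add: normalized_density_def s_def)
  moreover have "exp (3 * s / n) \<le> 1 + 3 * exp 3 * s / n" "exp (3 * s / n) \<le> exp 3" if "s \<le> n"
  proof -
    have t: "0 \<le> 3 * s / n" "3 * s / n \<le> 3" using that s0 n by (auto simp: field_simps)
    have "1 - 3 * s / n \<le> exp (- (3 * s / n))" using exp_ge_add_one_self[of "- (3 * s / n)"] by simp
    then have "exp (3 * s / n) * (1 - 3 * s / n) \<le> exp (3 * s / n) * exp (- (3 * s / n))"
      by (intro mult_left_mono) auto
    then have "exp (3 * s / n) \<le> 1 + exp (3 * s / n) * (3 * s / n)"
      by (simp add: algebra_simps flip: exp_add)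
    also have "exp (3 * s / n) * (3 * s / n) \<le> exp 3 * (3 * s / n)"
      using t by (intro mult_right_mono) auto
    finally show "exp (3 * s / n) \<le> 1 + 3 * exp 3 * s / n" by (simp add: ac_simps)
    show "exp (3 * s / n) \<le> exp 3" using t by simp
  qed
  moreover have "0 \<le> 3 * exp 3 * s / n" using s0 by simp
  ultimately have "normalized_density n u v \<le> 1 + 3 * exp 3 * s / n \<and> normalized_density n u v \<le> exp 3"
    by (cases "s \<le> n") (auto intro: order_trans)
  then show ?A ?B by (auto simp: s_def)
qed

text \<open>If s^2 > n, with s = u + v, the bound is negative. Otherwise Bernoulli's inequality is
  applied to 1 - (s/n)^2 = (1 - s/n)(1 + s/n); the second factor is at most exp (s/n), so its n-th
  power is absorbed by exp s. The summand 3/n pays for the prefactor (n-1)(n-2)/n^2 \<ge> 1 -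
  3/n.\<close>

lemma normalized_density_ge:
  assumes n: "n \<ge> 3" and uv: "0 \<le> u" "0 \<le> v"
  shows "normalized_density n u v \<ge> 1 - (3 + (u + v)\<^sup>2) / n"
proof -
  define s where "s = u + v"
  have s0: "0 \<le> s" using uv by (simp add: s_def)
  have p0: "0 \<le> normalized_density n u v" by (rule normalized_density_nonneg[OF n])
  show ?thesis
  proof (cases "s\<^sup>2 \<le> n")
    case False
    then have "1 \<le> s\<^sup>2 / n" using n by (simp add: field_simps)
    also have "\<dots> \<le> (3 + s\<^sup>2) / n" by (intro divide_right_mono) auto
    finally show ?thesis using p0 by (simp add: s_def)
  next
    case True
    have sn: "s \<le> n"
    proof (rule ccontr)
      assume "\<not> s \<le> n"
      then have "real n * real n < s * s" using n by (intro mult_strict_mono) auto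
      moreover have "real n * 1 \<le> real n * real n" using n by (intro mult_left_mono) auto
      ultimately show False using True by (simp add: power2_eq_square)
    qed
    define w where "w = 1 - s / n"
    have w: "0 \<le> w" "w \<le> 1" using sn s0 n by (auto simp: w_def)
    have b: "- 1 \<le> - (s / n)\<^sup>2"
      using sn s0 n by (auto simp: power_le_one)
    have "1 - s\<^sup>2 / n = 1 + real n * (- (s / n)\<^sup>2)"
      using n by (simp add: power2_eq_square)
    also have "\<dots> \<le> (1 + - (s / n)\<^sup>2) ^ n"
      using b by (rule Bernoulli_inequality)
    also have "1 + - (s / n)\<^sup>2 = w * (1 + s / n)"
      by (simp add: w_def algebra_simps power2_eq_square)
    also have "(w * (1 + s / n)) ^ n \<le> (w * exp (s / n)) ^ n"
      using w s0 exp_ge_add_one_self[of "s / n"] by (intro power_mono mult_left_mono) auto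
    also have "\<dots> = w ^ n * exp s"
      using n by (simp add: power_mult_distrib flip: exp_of_nat_mult)
    also have "\<dots> \<le> w ^ (n - 3) * exp s"
      using w by (intro mult_right_mono power_decreasing) auto
    finally have F: "1 - s\<^sup>2 / n \<le> w ^ (n - 3) * exp s" .
    have "1 - (3 + s\<^sup>2) / n \<le> (1 - 3 / n) * (1 - s\<^sup>2 / n)"
      using n by (simp add: field_simps)
    also have "\<dots> \<le> (real n - 1) * (real n - 2) / n\<^sup>2 * (w ^ (n - 3) * exp s)"
    proof (intro mult_mono F)
      have "1 - 3 / real n = (real n * real n - 3 * real n) / (real n)\<^sup>2" using n by (simp add: field_simps power2_eq_square)
      also have "\<dots> \<le> (real n - 1) * (real n - 2) / n\<^sup>2"
        by (simp add: divide_right_mono algebra_simps)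
      finally show "1 - 3 / real n \<le> (real n - 1) * (real n - 2) / n\<^sup>2" .
      show "0 \<le> (real n - 1) * (real n - 2) / n\<^sup>2" using n by simp
      show "0 \<le> 1 - s\<^sup>2 / n" using n True by (simp add: divide_le_eq_1)
    qed
    also have "\<dots> = normalized_density n u v"
      using sn by (simp add: normalized_density_def s_def w_def)
    finally show ?thesis by (simp add: s_def)
  qed
qed

text \<open>The error is put in product form so that, integrated against f u * f v, it factors into
  the square of a single integral.\<close>

lemma normalized_density_diff:
  assumes n: "n \<ge> 3" and uv: "0 \<le> u" "0 \<le> v"
  shows "\<bar>normalized_density n u v - 1\<bar> \<le> 6 * exp 3 / n * ((1 + u\<^sup>2) * (1 + v\<^sup>2))"
proof -
  define s where "s = u + v"
  have e: "(1::real) \<le> exp 3" by simp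
  have s1: "s \<le> 1 + s\<^sup>2"
    using zero_le_power2[of "s - 1/2"] by (simp add: power2_eq_square algebra_simps)
  have sq: "1 + s\<^sup>2 \<le> 2 * ((1 + u\<^sup>2) * (1 + v\<^sup>2))"
    using zero_le_power2[of "u - v"] zero_le_power2[of "u * v"]
    by (simp add: s_def power2_eq_square algebra_simps)
  have a1: "3 * exp 3 * s \<le> 3 * exp 3 * (1 + s\<^sup>2)" using s1 by simp
  have "3 * 1 * (1 + s\<^sup>2) \<le> 3 * exp 3 * (1 + s\<^sup>2)"
    by (intro mult_right_mono mult_left_mono e) auto
  moreover have "3 + s\<^sup>2 \<le> 3 * 1 * (1 + s\<^sup>2)" by simp
  ultimately have a2: "3 + s\<^sup>2 \<le> 3 * exp 3 * (1 + s\<^sup>2)" by linarith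
  have a3: "3 * exp 3 * (1 + s\<^sup>2) \<le> 6 * exp 3 * ((1 + u\<^sup>2) * (1 + v\<^sup>2))"
    using mult_left_mono[OF sq, of "3 * exp 3"] by (simp add: ac_simps)
  have "3 * exp 3 * s / n \<le> 6 * exp 3 * ((1 + u\<^sup>2) * (1 + v\<^sup>2)) / n"
    "(3 + s\<^sup>2) / n \<le> 6 * exp 3 * ((1 + u\<^sup>2) * (1 + v\<^sup>2)) / n"
    using order_trans[OF a1 a3] order_trans[OF a2 a3] by (auto intro!: divide_right_mono)
  then show ?thesis
    using normalized_density_le(1)[OF n uv] normalized_density_ge[OF n uv] by (simp add: s_def abs_le_iff)
qed

section \<open>Integrability under the exponential law, Cauchy-Schwarz, and integrals of
  products\<close>

lemma integrable_exp_law_exp: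
  assumes "a < 1" shows "integrable exp_law (\<lambda>x. exp (a * x))"
proof -
  interpret E: prob_space "density lborel (exponential_density (1 - a))"
    using assms by (intro prob_space_exponential_density) simp
  have "integrable (density lborel (exponential_density (1 - a))) (\<lambda>x. 1 / (1 - a) :: real)"
    by simp
  then have "integrable lborel (\<lambda>x. exponential_density (1 - a) x * (1 / (1 - a)))"
    using assms by (subst (asm) integrable_density) auto
  also have "(\<lambda>x. exponential_density (1 - a) x * (1 / (1 - a))) = (\<lambda>x. exponential_density 1 x * exp (a * x))"
    using assms by (auto simp: fun_eq_iff exponential_density_def right_diff_distrib mult.commute simp flip: exp_add)
  finally show ?thesis unfolding exp_law_def by (subst integrable_density) auto
qed

text \<open>Fourth power of 1 + x \<le> 16 (1 + x/16) \<le> 16 exp (x/16). The constant 16 leaves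
  the rate 1/4, which together with exp (x/2) stays below the critical rate 1.\<close>

lemma power4_le_exp: "(1 + x) ^ 4 \<le> 16 ^ 4 * exp (x / 4)" if "0 \<le> x" for x :: real
proof -
  have "1 + x \<le> 16 * exp (x / 16)" using exp_ge_add_one_self[of "x / 16"] that by linarith
  then have "(1 + x) ^ 4 \<le> (16 * exp (x / 16)) ^ 4" using that by (intro power_mono) auto
  also have "\<dots> = 16 ^ 4 * exp (x / 4)" by (simp add: power_mult_distrib flip: exp_of_nat_mult)
  finally show ?thesis .
qed

text \<open>The integrand is the square of (1 + x)^2 exp (x/4), the weight in the remainder of the
  exponential tilt; square integrability of that weight lets it be paired with a square integrable
  section of \<open>g\<close>.\<close>

lemma integrable_exp_law_power4_exp: "integrable exp_law (\<lambda>x. (1 + x) ^ 4 * exp (x / 2))"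
proof (rule Bochner_Integration.integrable_bound)
  show "integrable exp_law (\<lambda>x. 16 ^ 4 * exp (3 / 4 * x))"
    by (intro integrable_mult_right integrable_exp_law_exp) simp
  show "AE x in exp_law. norm ((1 + x) ^ 4 * exp (x / 2)) \<le> norm (16 ^ 4 * exp (3 / 4 * x))"
    using AE_exp_law_pos
  proof eventually_elim
    case (elim x)
    have "(1 + x) ^ 4 * exp (x / 2) \<le> 16 ^ 4 * exp (x / 4) * exp (x / 2)"
      using elim power4_le_exp[of x] by (intro mult_right_mono) auto
    also have "\<dots> = 16 ^ 4 * exp (3 / 4 * x)" by (simp flip: exp_add)
    finally show ?case by simp
  qed
qed simp

lemma integrable_exp_law_power4: "integrable exp_law (\<lambda>x. (1 + x) ^ 4)"
proof (rule Bochner_Integration.integrable_bound[OF integrable_exp_law_power4_exp])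
  show "AE x in exp_law. norm ((1 + x) ^ 4) \<le> norm ((1 + x) ^ 4 * exp (x / 2))"
    using AE_exp_law_pos
  proof eventually_elim
    case (elim x)
    have "(1 + x) ^ 4 * 1 \<le> (1 + x) ^ 4 * exp (x / 2)" using elim by (intro mult_left_mono) auto
    then show ?case by (simp add: abs_mult)
  qed
qed simp

lemma integrable_exp_law_weight: "integrable exp_law (\<lambda>x. (1 + x\<^sup>2)\<^sup>2)"
proof (rule Bochner_Integration.integrable_bound[OF integrable_exp_law_power4])
  show "AE x in exp_law. norm ((1 + x\<^sup>2)\<^sup>2) \<le> norm ((1 + x) ^ 4)"
    using AE_exp_law_pos
  proof eventually_elim
    case (elim x)
    then have "(1 + x\<^sup>2)\<^sup>2 \<le> ((1 + x)\<^sup>2)\<^sup>2" by (intro power_mono) (auto simp: power2_eq_square algebra_simps)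
    also have "\<dots> = (1 + x) ^ 4" by simp
    finally show ?case by simp
  qed
qed simp

lemma integrable_mult_of_squares:
  fixes f g :: "'a \<Rightarrow> real"
  assumes [measurable]: "f \<in> borel_measurable M" "g \<in> borel_measurable M"
    and "integrable M (\<lambda>x. (f x)\<^sup>2)" "integrable M (\<lambda>x. (g x)\<^sup>2)"
  shows "integrable M (\<lambda>x. f x * g x)"
proof (rule Bochner_Integration.integrable_bound[of _ "\<lambda>x. (f x)\<^sup>2 + (g x)\<^sup>2"])
  show "AE x in M. norm (f x * g x) \<le> norm ((f x)\<^sup>2 + (g x)\<^sup>2)"
  proof (rule AE_I2)
    fix x
    have "2 * \<bar>f x\<bar> * \<bar>g x\<bar> \<le> (f x)\<^sup>2 + (g x)\<^sup>2"
      using sum_squares_bound[of "\<bar>f x\<bar>" "\<bar>g x\<bar>"] by simp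
    moreover have "0 \<le> \<bar>f x\<bar> * \<bar>g x\<bar>" by simp
    ultimately have "\<bar>f x\<bar> * \<bar>g x\<bar> \<le> (f x)\<^sup>2 + (g x)\<^sup>2" by linarith
    then show "norm (f x * g x) \<le> norm ((f x)\<^sup>2 + (g x)\<^sup>2)" by (simp add: abs_mult)
  qed
qed (use assms in auto)

lemma Cauchy_Schwarz_integral:
  fixes f g :: "'a \<Rightarrow> real"
  assumes [measurable]: "f \<in> borel_measurable M" "g \<in> borel_measurable M"
    and f: "integrable M (\<lambda>x. (f x)\<^sup>2)" and g: "integrable M (\<lambda>x. (g x)\<^sup>2)"
  shows "(\<integral>x. f x * g x \<partial>M)\<^sup>2 \<le> (\<integral>x. (f x)\<^sup>2 \<partial>M) * (\<integral>x. (g x)\<^sup>2 \<partial>M)"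
proof -
  define A B D where "A = (\<integral>x. (f x)\<^sup>2 \<partial>M)" and "B = (\<integral>x. f x * g x \<partial>M)" and "D = (\<integral>x. (g x)\<^sup>2 \<partial>M)"
  have fg: "integrable M (\<lambda>x. f x * g x)" by (rule integrable_mult_of_squares) fact+
  have D0: "D \<ge> 0" unfolding D_def by simp
  have q: "0 \<le> A + 2 * t * B + t\<^sup>2 * D" for t
  proof -
    have "0 \<le> (\<integral>x. (f x + t * g x)\<^sup>2 \<partial>M)" by simp
    also have "\<dots> = (\<integral>x. (f x)\<^sup>2 + (2 * t) * (f x * g x) + t\<^sup>2 * (g x)\<^sup>2 \<partial>M)"
      by (intro Bochner_Integration.integral_cong refl) (simp add: power2_eq_square algebra_simps)
    also have "\<dots> = A + 2 * t * B + t\<^sup>2 * D"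
      using f g fg by (simp add: A_def B_def D_def)
    finally show ?thesis .
  qed
  have "B\<^sup>2 \<le> A * D"
  proof (cases "D = 0")
    case True
    have "B = 0"
    proof (rule ccontr)
      assume "B \<noteq> 0"
      \<comment> \<open>For D = 0 the quadratic is affine in t, and this t gives it the value
        -1.\<close>
      then show False using q[of "- (A + 1) / (2 * B)"] True by (simp add: field_simps)
    qed
    then show ?thesis using True by simp
  next
    case False
    then show ?thesis using q[of "- B / D"] D0 by (simp add: field_simps power2_eq_square)
  qed
  then show ?thesis by (simp add: A_def B_def D_def)
qed

lemma (in pair_sigma_finite) integrable_product:
  fixes f :: "'a \<Rightarrow> real" and g :: "'b \<Rightarrow> real"
  assumes f: "integrable M1 f" and g: "integrable M2 g"
  shows "integrable (M1 \<Otimes>\<^sub>M M2) (\<lambda>z. f (fst z) * g (snd z))"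
    and "(\<integral>z. f (fst z) * g (snd z) \<partial>(M1 \<Otimes>\<^sub>M M2)) = (\<integral>x. f x \<partial>M1) * (\<integral>y. g y \<partial>M2)"
proof -
  have [measurable]: "f \<in> borel_measurable M1" "g \<in> borel_measurable M2" using f g by auto
  show *: "integrable (M1 \<Otimes>\<^sub>M M2) (\<lambda>z. f (fst z) * g (snd z))"
  proof (rule Fubini_integrable)
    show "integrable M1 (\<lambda>x. \<integral>y. norm (f (fst (x, y)) * g (snd (x, y))) \<partial>M2)"
      using f g by (simp add: abs_mult)
  qed (use g in auto)
  show "(\<integral>z. f (fst z) * g (snd z) \<partial>(M1 \<Otimes>\<^sub>M M2)) = (\<integral>x. f x \<partial>M1) * (\<integral>y. g y \<partial>M2)"
    using integral_fst'[OF *] by simp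
qed

section \<open>Sums over a normalized sample\<close>

lemma AE_exp_law_pair_pos: "AE z in exp_law \<Otimes>\<^sub>M exp_law. 0 < fst z \<and> 0 < snd z"
proof (rule exp_law2.AE_pair_measure)
  show "AE x in exp_law. AE y in exp_law. 0 < fst (x, y) \<and> 0 < snd (x, y)"
    using AE_exp_law_pos
  proof eventually_elim
    case (elim x)
    then show ?case using AE_exp_law_pos by auto
  qed
qed measurable

text \<open>In the second moment of a centered sum, exp 3 accounts for the n diagonal terms, through
  the bound on the density. The summand with 6 accounts for the at most n^2 off-diagonal terms, each
  of order 1/n by \<open>normalized_density_diff\<close>; the integral is the squared norm of its
  weight.\<close>

definition normalization_const :: real where
  "normalization_const = exp 3 * (1 + 6 * (\<integral>u. (1 + u\<^sup>2)\<^sup>2 \<partial>exp_law))"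

lemma normalization_const_pos: "normalization_const > 0"
  unfolding normalization_const_def by (intro mult_pos_pos add_pos_nonneg) auto

context exponential_sample begin

text \<open>The marginal law is read off from a pair: an auxiliary index k different from i is
  integrated out after bounding the joint density by exp 3.\<close>

lemma nn_integral_normalized_le:
  assumes i: "i \<in> {1..n}" and n: "n \<ge> 3" and [measurable]: "h \<in> borel_measurable borel"
  shows "(\<integral>\<^sup>+\<omega>. h (normalized X n i \<omega>) \<partial>M) \<le> ennreal (exp 3) * (\<integral>\<^sup>+u. h u \<partial>exp_law)"
proof -
  obtain k where k: "k \<in> {1..n}" "i \<noteq> k"
    using n i by (cases "i = 1") (auto intro: that[of 1] that[of 2])
  have "(\<integral>\<^sup>+\<omega>. h (normalized X n i \<omega>) \<partial>M) =
    (\<integral>\<^sup>+u. \<integral>\<^sup>+v. ennreal (normalized_density n u v) * h u \<partial>exp_law \<partial>exp_law)"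
    by (rule nn_integral_normalized_pair[OF i k n]) measurable
  also have "\<dots> \<le> (\<integral>\<^sup>+u. \<integral>\<^sup>+v. ennreal (exp 3) * h u \<partial>exp_law \<partial>exp_law)"
  proof (rule nn_integral_mono_AE, use AE_exp_law_pos in eventually_elim)
    fix u :: real assume u: "0 < u"
    show "(\<integral>\<^sup>+v. ennreal (normalized_density n u v) * h u \<partial>exp_law) \<le> (\<integral>\<^sup>+v. ennreal (exp 3) * h u \<partial>exp_law)"
    proof (rule nn_integral_mono_AE, use AE_exp_law_pos in eventually_elim)
      fix v :: real assume v: "0 < v"
      show "ennreal (normalized_density n u v) * h u \<le> ennreal (exp 3) * h u"
        using normalized_density_le(2)[OF n, of u v] u v by (intro mult_right_mono ennreal_leI) auto
    qed
  qed
  also have "\<dots> = ennreal (exp 3) * (\<integral>\<^sup>+u. h u \<partial>exp_law)"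
    by (simp add: nn_integral_cmult exp_law.emeasure_space_1[simplified])
  finally show ?thesis .
qed

text \<open>The formula for nonnegative integrands, tested on indicators, becomes an equality of
  measures, so that signed integrands such as products of centered functions can be treated.\<close>

lemma distr_normalized_pair:
  assumes ik: "i \<in> {1..n}" "k \<in> {1..n}" "i \<noteq> k" and n: "n \<ge> 3"
  shows "distr M (borel \<Otimes>\<^sub>M borel) (\<lambda>\<omega>. (normalized X n i \<omega>, normalized X n k \<omega>)) =
    density (exp_law \<Otimes>\<^sub>M exp_law) (\<lambda>(u, v). ennreal (normalized_density n u v))"
proof (rule measure_eqI)
  show "sets (distr M (borel \<Otimes>\<^sub>M borel) (\<lambda>\<omega>. (normalized X n i \<omega>, normalized X n k \<omega>))) =
    sets (density (exp_law \<Otimes>\<^sub>M exp_law) (\<lambda>(u, v). ennreal (normalized_density n u v)))"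
    by (simp cong: sets_pair_measure_cong)
  fix A assume "A \<in> sets (distr M (borel \<Otimes>\<^sub>M borel) (\<lambda>\<omega>. (normalized X n i \<omega>, normalized X n k \<omega>)))"
  then have A [measurable]: "A \<in> sets (borel \<Otimes>\<^sub>M borel)" by simp
  then have A' [measurable]: "A \<in> sets (exp_law \<Otimes>\<^sub>M exp_law)" by (simp cong: sets_pair_measure_cong)
  have [measurable]: "normalized X n i \<in> borel_measurable M" "normalized X n k \<in> borel_measurable M"
    using ik by auto
  have "emeasure (distr M (borel \<Otimes>\<^sub>M borel) (\<lambda>\<omega>. (normalized X n i \<omega>, normalized X n k \<omega>))) A =
    (\<integral>\<^sup>+\<omega>. indicator A (normalized X n i \<omega>, normalized X n k \<omega>) \<partial>M)"
    by (subst nn_integral_indicator[symmetric], simp) (subst nn_integral_distr, auto)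
  also have "\<dots> = (\<integral>\<^sup>+u. \<integral>\<^sup>+v. ennreal (normalized_density n u v) * indicator A (u, v) \<partial>exp_law \<partial>exp_law)"
    by (rule nn_integral_normalized_pair[OF ik n]) simp
  also have "\<dots> = (\<integral>\<^sup>+z. (\<lambda>(u, v). ennreal (normalized_density n u v)) z * indicator A z \<partial>(exp_law \<Otimes>\<^sub>M exp_law))"
    by (subst exp_law.nn_integral_fst[symmetric]) (auto cong: measurable_cong_sets)
  also have "\<dots> = emeasure (density (exp_law \<Otimes>\<^sub>M exp_law) (\<lambda>(u, v). ennreal (normalized_density n u v))) A"
    by (subst emeasure_density) auto
  finally show "emeasure (distr M (borel \<Otimes>\<^sub>M borel) (\<lambda>\<omega>. (normalized X n i \<omega>, normalized X n k \<omega>))) A =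
    emeasure (density (exp_law \<Otimes>\<^sub>M exp_law) (\<lambda>(u, v). ennreal (normalized_density n u v))) A" .
qed

text \<open>As \<open>f\<close> has mean zero, the product law contributes nothing and the density
  may be replaced by its difference from 1. The product-form bound on this difference gives the
  square of the integral of \<bar>f u\<bar> (1 + u^2), which Cauchy-Schwarz turns into the norm of
  \<open>f\<close>.\<close>

lemma normalized_pair_correlation:
  assumes ik: "i \<in> {1..n}" "k \<in> {1..n}" "i \<noteq> k" and n: "n \<ge> 3"
    and [measurable]: "f \<in> borel_measurable borel"
    and f2: "integrable exp_law (\<lambda>u. (f u)\<^sup>2)" and f0: "(\<integral>u. f u \<partial>exp_law) = 0"
  shows "(\<integral>\<omega>. f (normalized X n i \<omega>) * f (normalized X n k \<omega>) \<partial>M)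
     \<le> 6 * exp 3 / n * (\<integral>u. (1 + u\<^sup>2)\<^sup>2 \<partial>exp_law) * (\<integral>u. (f u)\<^sup>2 \<partial>exp_law)"
proof -
  have [measurable]: "normalized X n i \<in> borel_measurable M" "normalized X n k \<in> borel_measurable M"
    using ik by auto
  have [measurable]: "(\<lambda>z. normalized_density n (fst z) (snd z)) \<in> borel_measurable (exp_law \<Otimes>\<^sub>M exp_law)"
    using measurable_normalized_density[of n] by (simp add: case_prod_beta' cong: measurable_cong_sets)
  let ?P = "exp_law \<Otimes>\<^sub>M exp_law" and ?p = "\<lambda>z. normalized_density n (fst z) (snd z)"
  define w where "w u = \<bar>f u\<bar> * (1 + u\<^sup>2)" for u :: real
  have [measurable]: "w \<in> borel_measurable borel" unfolding w_def by measurable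
  have fi: "integrable exp_law f"
    by (rule exp_law.square_integrable_imp_integrable[OF _ f2]) simp
  have wi: "integrable exp_law w"
    unfolding w_def by (rule integrable_mult_of_squares) (use f2 integrable_exp_law_weight in auto)
  note ff = exp_law2.integrable_product[OF fi fi]
  note ww = exp_law2.integrable_product[OF wi wi]
  have bound: "AE z in ?P. \<bar>(?p z - 1) * (f (fst z) * f (snd z))\<bar> \<le> 6 * exp 3 / n * (w (fst z) * w (snd z))"
    using AE_exp_law_pair_pos
  proof eventually_elim
    case (elim z)
    have "\<bar>?p z - 1\<bar> * (\<bar>f (fst z)\<bar> * \<bar>f (snd z)\<bar>) \<le>
       6 * exp 3 / n * ((1 + (fst z)\<^sup>2) * (1 + (snd z)\<^sup>2)) * (\<bar>f (fst z)\<bar> * \<bar>f (snd z)\<bar>)"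
      using elim by (intro mult_right_mono normalized_density_diff[OF n]) auto
    then show ?case by (simp add: abs_mult w_def ac_simps)
  qed
  have di: "integrable ?P (\<lambda>z. (?p z - 1) * (f (fst z) * f (snd z)))"
    by (rule Bochner_Integration.integrable_bound[OF integrable_mult_right[OF ww(1), of "6 * exp 3 / n"]])
       (use bound in \<open>auto elim!: eventually_mono simp: abs_mult w_def\<close>)
  have "(\<integral>\<omega>. f (normalized X n i \<omega>) * f (normalized X n k \<omega>) \<partial>M) =
     (\<integral>z. f (fst z) * f (snd z) \<partial>distr M (borel \<Otimes>\<^sub>M borel) (\<lambda>\<omega>. (normalized X n i \<omega>, normalized X n k \<omega>)))"
    by (subst integral_distr) auto
  also have "\<dots> = (\<integral>z. ?p z * (f (fst z) * f (snd z)) \<partial>?P)"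
    unfolding distr_normalized_pair[OF ik n] case_prod_beta'
    by (subst integral_density) (use normalized_density_nonneg[OF n] in \<open>auto\<close>)
  also have "\<dots> = (\<integral>z. (?p z - 1) * (f (fst z) * f (snd z)) + f (fst z) * f (snd z) \<partial>?P)"
    by (intro Bochner_Integration.integral_cong refl) (simp add: algebra_simps)
  also have "\<dots> = (\<integral>z. (?p z - 1) * (f (fst z) * f (snd z)) \<partial>?P)"
    using di ff f0 by simp
  also have "\<dots> \<le> (\<integral>z. 6 * exp 3 / n * (w (fst z) * w (snd z)) \<partial>?P)"
    by (rule integral_mono_AE[OF di]) (use ww bound in \<open>auto elim!: eventually_mono\<close>)
  also have "\<dots> = 6 * exp 3 / n * (\<integral>u. w u \<partial>exp_law)\<^sup>2"
    using ww by (simp add: power2_eq_square)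
  also have "\<dots> \<le> 6 * exp 3 / n * ((\<integral>u. \<bar>f u\<bar>\<^sup>2 \<partial>exp_law) * (\<integral>u. (1 + u\<^sup>2)\<^sup>2 \<partial>exp_law))"
    unfolding w_def
    by (intro mult_left_mono Cauchy_Schwarz_integral) (use f2 integrable_exp_law_weight in auto)
  finally show ?thesis by (simp add: ac_simps)
qed

text \<open>
  The mean of \<open>f\<close> matters only if \<open>f\<close> is square integrable: otherwise the right-hand side is infinite.
\<close>

lemma nn_integral_normalized_sum_le:
  assumes n: "n \<ge> 3" and f [measurable]: "f \<in> borel_measurable borel"
    and f0: "integrable exp_law (\<lambda>u. (f u)\<^sup>2) \<Longrightarrow> (\<integral>u. f u \<partial>exp_law) = 0"
  shows "(\<integral>\<^sup>+\<omega>. ennreal ((\<Sum>i=1..n. f (normalized X n i \<omega>))\<^sup>2) \<partial>M)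
     \<le> ennreal (normalization_const * n) * (\<integral>\<^sup>+u. ennreal ((f u)\<^sup>2) \<partial>exp_law)"
proof (cases "integrable exp_law (\<lambda>u. (f u)\<^sup>2)")
  case False
  then have "(\<integral>\<^sup>+u. ennreal ((f u)\<^sup>2) \<partial>exp_law) = \<infinity>"
    by (auto simp: integrable_iff_bounded less_top[symmetric])
  then show ?thesis using normalization_const_pos n by (simp add: ennreal_mult_top)
next
  case f2: True
  define A where "A = (\<integral>u. (f u)\<^sup>2 \<partial>exp_law)"
  define K where "K = (\<integral>u. (1 + u\<^sup>2)\<^sup>2 \<partial>exp_law)"
  have A0: "0 \<le> A" unfolding A_def by simp
  have K0: "0 \<le> K" unfolding K_def by simp
  have A: "(\<integral>\<^sup>+u. ennreal ((f u)\<^sup>2) \<partial>exp_law) = ennreal A"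
    unfolding A_def by (rule nn_integral_eq_integral[OF f2]) simp
  define x where "x i \<omega> = f (normalized X n i \<omega>)" for i \<omega>
  have [measurable]: "x i \<in> borel_measurable M" if "i \<in> {1..n}" for i
    unfolding x_def using that by (intro measurable_compose[OF measurable_normalized f]) auto
  have le: "(\<integral>\<^sup>+\<omega>. ennreal ((x i \<omega>)\<^sup>2) \<partial>M) \<le> ennreal (exp 3 * A)" if "i \<in> {1..n}" for i
    using nn_integral_normalized_le[OF that n, of "\<lambda>u. ennreal ((f u)\<^sup>2)"] A0
    unfolding A by (simp add: x_def ennreal_mult)
  have x2: "integrable M (\<lambda>\<omega>. (x i \<omega>)\<^sup>2)" if "i \<in> {1..n}" for i
    using le[OF that] that by (intro integrableI_bounded) (auto simp: ennreal_less_top intro: le_less_trans)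
  have x2le: "(\<integral>\<omega>. (x i \<omega>)\<^sup>2 \<partial>M) \<le> exp 3 * A" if "i \<in> {1..n}" for i
    using le[OF that] A0 that by (subst (asm) nn_integral_eq_integral[OF x2]) auto
  have xx: "integrable M (\<lambda>\<omega>. x i \<omega> * x k \<omega>)" if "i \<in> {1..n}" "k \<in> {1..n}" for i k
    using that by (intro integrable_mult_of_squares x2) auto
  \<comment> \<open>The nonnegative off-diagonal bound is also added on the diagonal, so that one
    expression can be summed over all pairs.\<close>
  have xxle: "(\<integral>\<omega>. x i \<omega> * x k \<omega> \<partial>M) \<le> (if i = k then exp 3 * A else 0) + 6 * exp 3 / n * K * A"
    if "i \<in> {1..n}" "k \<in> {1..n}" for i k
  proof (cases "i = k")
    case True
    have "(\<integral>\<omega>. x i \<omega> * x k \<omega> \<partial>M) = (\<integral>\<omega>. (x i \<omega>)\<^sup>2 \<partial>M)" using True by (simp add: power2_eq_square)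
    also have "\<dots> \<le> exp 3 * A + 0" using x2le that by simp
    also have "\<dots> \<le> exp 3 * A + 6 * exp 3 / n * K * A" using A0 K0 by (intro add_left_mono) simp
    finally show ?thesis using True by simp
  next
    case False
    then show ?thesis
      using normalized_pair_correlation[OF that False n f f2 f0[OF f2]] by (simp add: x_def A_def K_def)
  qed
  have sq: "(\<Sum>i=1..n. x i \<omega>)\<^sup>2 = (\<Sum>i=1..n. \<Sum>k=1..n. x i \<omega> * x k \<omega>)" for \<omega>
    by (simp add: power2_eq_square sum_product)
  have int: "integrable M (\<lambda>\<omega>. (\<Sum>i=1..n. x i \<omega>)\<^sup>2)"
    unfolding sq using xx by (intro Bochner_Integration.integrable_sum) auto
  have "(\<integral>\<omega>. (\<Sum>i=1..n. x i \<omega>)\<^sup>2 \<partial>M) = (\<Sum>i=1..n. \<Sum>k=1..n. (\<integral>\<omega>. x i \<omega> * x k \<omega> \<partial>M))"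
    unfolding sq using xx by (subst Bochner_Integration.integral_sum, auto)+
  also have "\<dots> \<le> (\<Sum>i=1..n. \<Sum>k=1..n. (if i = k then exp 3 * A else 0) + 6 * exp 3 / n * K * A)"
    using xxle by (intro sum_mono) auto
  also have "\<dots> = n * (exp 3 * A) + n * (n * (6 * exp 3 / n * K * A))"
    by (simp add: sum.distrib sum.delta' distrib_left mult.assoc)
  also have "\<dots> = normalization_const * n * A"
  proof -
    have "real n * (6 * exp 3 / n * K * A) = 6 * exp 3 * K * A" using n by simp
    then show ?thesis unfolding normalization_const_def K_def[symmetric] by algebra
  qed
  finally have "(\<integral>\<omega>. (\<Sum>i=1..n. x i \<omega>)\<^sup>2 \<partial>M) \<le> normalization_const * n * A" .
  then have "(\<integral>\<^sup>+\<omega>. ennreal ((\<Sum>i=1..n. x i \<omega>)\<^sup>2) \<partial>M) \<le> ennreal (normalization_const * n * A)"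
    by (subst nn_integral_eq_integral[OF int]) (auto intro: ennreal_leI)
  then show ?thesis unfolding A x_def
    using A0 normalization_const_pos by (simp add: ennreal_mult)
qed

end

section \<open>Conditional means of the kernel\<close>

text \<open>Everything follows from 1 + z \<le> exp z at z and at -z, that is, z \<le> exp z - 1
  \<le> z exp z. Subtracting z bounds the second remainder by z (exp z - 1), to which the first
  estimate applies.\<close>

lemma exp_diff_bounds:
  fixes z :: real
  shows "\<bar>exp z - 1\<bar> \<le> \<bar>z\<bar> * exp \<bar>z\<bar>" and "\<bar>exp z - 1 - z\<bar> \<le> z\<^sup>2 * exp \<bar>z\<bar>"
proof -
  have lower: "z \<le> exp z - 1" using exp_ge_add_one_self[of z] by linarith
  have "1 - z \<le> exp (- z)" using exp_ge_add_one_self[of "- z"] by simp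
  then have "exp z * (1 - z) \<le> exp z * exp (- z)" by (intro mult_left_mono) auto
  then have upper: "exp z - 1 \<le> z * exp z" by (simp add: algebra_simps flip: exp_add)
  show *: "\<bar>exp z - 1\<bar> \<le> \<bar>z\<bar> * exp \<bar>z\<bar>"
  proof (cases "0 \<le> z")
    case True
    then show ?thesis using upper by simp
  next
    case False
    have "\<bar>exp z - 1\<bar> \<le> \<bar>z\<bar> * 1" using False lower by simp
    also have "\<dots> \<le> \<bar>z\<bar> * exp \<bar>z\<bar>" by (intro mult_left_mono) auto
    finally show ?thesis .
  qed
  have "\<bar>exp z - 1 - z\<bar> \<le> z * (exp z - 1)"
    using lower upper by (simp add: algebra_simps)
  also have "\<dots> \<le> \<bar>z\<bar> * \<bar>exp z - 1\<bar>" by (metis abs_ge_self abs_mult)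
  also have "\<dots> \<le> \<bar>z\<bar> * (\<bar>z\<bar> * exp \<bar>z\<bar>)" using * by (intro mult_left_mono) auto
  finally show "\<bar>exp z - 1 - z\<bar> \<le> z\<^sup>2 * exp \<bar>z\<bar>" by (simp add: power2_eq_square ac_simps)
qed

text \<open>The expanded function is the density of the exponential law of rate \<theta> relative to
  that of rate 1. With d = \<theta> - 1 and z = -d v the error is (exp z - 1 - z) + d (exp z - 1),
  quadratic in d. The threshold 1/4 keeps exp \<bar>z\<bar> below exp (v/4), whose square is still
  integrable.\<close>

lemma exponential_tilt_expansion:
  fixes \<theta> v :: real
  assumes d: "\<bar>\<theta> - 1\<bar> \<le> 1 / 4" and v: "0 \<le> v"
  shows "\<bar>\<theta> * exp (- (\<theta> - 1) * v) - 1 - (\<theta> - 1) * (1 - v)\<bar> \<le> (\<theta> - 1)\<^sup>2 * ((1 + v)\<^sup>2 * exp (v / 4))"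
proof -
  define d where "d = \<theta> - 1"
  define z where "z = - d * v"
  have "\<bar>z\<bar> \<le> v / 4" using mult_right_mono[OF d v] v by (simp add: z_def d_def abs_mult abs_minus_commute)
  then have e: "exp \<bar>z\<bar> \<le> exp (v / 4)" by simp
  have "\<bar>\<theta> * exp (- (\<theta> - 1) * v) - 1 - (\<theta> - 1) * (1 - v)\<bar> = \<bar>(exp z - 1 - z) + d * (exp z - 1)\<bar>"
    by (simp add: z_def d_def algebra_simps)
  also have "\<dots> \<le> \<bar>exp z - 1 - z\<bar> + \<bar>d\<bar> * \<bar>exp z - 1\<bar>" by (metis abs_mult abs_triangle_ineq)
  also have "\<dots> \<le> z\<^sup>2 * exp \<bar>z\<bar> + \<bar>d\<bar> * (\<bar>z\<bar> * exp \<bar>z\<bar>)"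
    by (intro add_mono mult_left_mono exp_diff_bounds) auto
  also have "\<dots> \<le> z\<^sup>2 * exp (v / 4) + \<bar>d\<bar> * (\<bar>z\<bar> * exp (v / 4))"
    using e by (intro add_mono mult_left_mono) auto
  also have "\<dots> = d\<^sup>2 * ((v\<^sup>2 + v) * exp (v / 4))"
    using v by (simp add: z_def abs_mult power2_eq_square algebra_simps)
  also have "\<dots> \<le> d\<^sup>2 * ((1 + v)\<^sup>2 * exp (v / 4))"
    using v by (intro mult_left_mono mult_right_mono) (auto simp: power2_eq_square algebra_simps)
  finally show ?thesis by (simp add: d_def)
qed

lemma exp_law_moments:
  "integrable exp_law (\<lambda>x. x)" "(\<integral>x. x \<partial>exp_law) = 1"
  "integrable exp_law (\<lambda>x. x\<^sup>2)" "(\<integral>x. x\<^sup>2 \<partial>exp_law) = 2"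
proof -
  have D: "distributed exp_law lborel (\<lambda>x. x) (exponential_density 1)"
    unfolding distributed_def by (auto simp: exp_law_def intro!: distr_id2)
  note m = exp_law.erlang_ith_moment_integrable[OF _ D] exp_law.erlang_ith_moment[OF _ D]
  show "integrable exp_law (\<lambda>x. x)" "(\<integral>x. x \<partial>exp_law) = 1"
    using m(1)[of 1] m(2)[of 1] by auto
  show "integrable exp_law (\<lambda>x. x\<^sup>2)" "(\<integral>x. x\<^sup>2 \<partial>exp_law) = 2"
    using m(1)[of 2] m(2)[of 2] by (auto simp: numeral_2_eq_2)
qed

lemma exp_law_centered_moments:
  "integrable exp_law (\<lambda>x. x - 1)" "(\<integral>x. x - 1 \<partial>exp_law) = 0"
  "integrable exp_law (\<lambda>x. (x - 1)\<^sup>2)" "(\<integral>x. (x - 1)\<^sup>2 \<partial>exp_law) = 1"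
proof -
  show "integrable exp_law (\<lambda>x. x - 1)" "(\<integral>x. x - 1 \<partial>exp_law) = 0"
    using exp_law_moments exp_law.prob_space by auto
  have *: "(x - 1)\<^sup>2 = x\<^sup>2 - 2 * x + 1" for x :: real by (simp add: power2_eq_square algebra_simps)
  show "integrable exp_law (\<lambda>x. (x - 1)\<^sup>2)" "(\<integral>x. (x - 1)\<^sup>2 \<partial>exp_law) = 1"
    unfolding * using exp_law_moments exp_law.prob_space by auto
qed

locale product_kernel =
  fixes g :: "real \<Rightarrow> real"
  assumes measurable_g [measurable]: "g \<in> borel_measurable borel"
    and square_integrable: "integrable (exp_law \<Otimes>\<^sub>M exp_law) (\<lambda>z. (g (fst z * snd z))\<^sup>2)"
begin

definition section_mean :: "real \<Rightarrow> real" where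
  "section_mean x = (\<integral>v. g (x * v) \<partial>exp_law)"

text \<open>With \<open>section_mean\<close> being the function A of the overview, this is, for
  almost every x, the derivative of \<open>section_mean (x / \<theta>)\<close> in \<theta> at
  \<theta> = 1. The factor 1 - v is the derivative of the tilt.\<close>

definition section_drift :: "real \<Rightarrow> real" where
  "section_drift x = (\<integral>v. g (x * v) * (1 - v) \<partial>exp_law)"

text \<open>The coefficient of (\<theta> - 1)^2 in the remainder of that first-order
  expansion.\<close>

definition section_weight :: "real \<Rightarrow> real" where
  "section_weight x = (\<integral>v. \<bar>g (x * v)\<bar> * ((1 + v)\<^sup>2 * exp (v / 4)) \<partial>exp_law)"

definition kernel_mean :: real where
  "kernel_mean = (\<integral>x. section_mean x \<partial>exp_law)"

text \<open>The second-order term of the Hoeffding decomposition. Both first-order terms use the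
  same function because g (x * y) is symmetric.\<close>

definition degenerate_part :: "real \<Rightarrow> real \<Rightarrow> real" where
  "degenerate_part x y = g (x * y) - section_mean x - section_mean y + kernel_mean"

lemma measurable_section [measurable]:
  "section_mean \<in> borel_measurable borel" "section_drift \<in> borel_measurable borel"
  "section_weight \<in> borel_measurable borel"
  unfolding section_mean_def[abs_def] section_drift_def[abs_def] section_weight_def[abs_def]
  by measurable

lemma measurable_degenerate_part [measurable]:
  "(\<lambda>(x, y). degenerate_part x y) \<in> borel_measurable (borel \<Otimes>\<^sub>M borel)"
  unfolding degenerate_part_def by measurable

text \<open>Fubini provides this for almost every x only. At the exceptional points the integrals
  defining the sections may be the default value 0, which is why the later statements about sections
  hold almost everywhere or assume square integrability at x.\<close>

lemma AE_section_square_integrable: "AE x in exp_law. integrable exp_law (\<lambda>v. (g (x * v))\<^sup>2)"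
  using exp_law2.AE_integrable_fst'[OF square_integrable] by simp

lemma integrable_section_square: "integrable exp_law (\<lambda>x. \<integral>v. (g (x * v))\<^sup>2 \<partial>exp_law)"
  using exp_law2.integrable_fst'[OF square_integrable] by simp

lemma integrable_section:
  assumes "integrable exp_law (\<lambda>v. (g (x * v))\<^sup>2)"
  shows "integrable exp_law (\<lambda>v. g (x * v))"
    and "integrable exp_law (\<lambda>v. g (x * v) * (1 - v))"
    and "integrable exp_law (\<lambda>v. \<bar>g (x * v)\<bar> * ((1 + v)\<^sup>2 * exp (v / 4)))"
proof -
  show "integrable exp_law (\<lambda>v. g (x * v))"
    by (rule exp_law.square_integrable_imp_integrable) (use assms in auto)
  show "integrable exp_law (\<lambda>v. g (x * v) * (1 - v))"
    using exp_law_centered_moments(3) assms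
    by (intro integrable_mult_of_squares) (auto simp: power2_commute)
  have *: "((1 + v)\<^sup>2 * exp (v / 4))\<^sup>2 = (1 + v) ^ 4 * exp (v / 2)" for v :: real
    by (simp add: power_mult_distrib flip: exp_of_nat_mult power_mult)
  show "integrable exp_law (\<lambda>v. \<bar>g (x * v)\<bar> * ((1 + v)\<^sup>2 * exp (v / 4)))"
    by (intro integrable_mult_of_squares) (use assms in \<open>auto simp: * integrable_exp_law_power4_exp\<close>)
qed

lemma integrable_section_mean_square: "integrable exp_law (\<lambda>x. (section_mean x)\<^sup>2)"
proof (rule Bochner_Integration.integrable_bound[OF integrable_section_square])
  show "AE x in exp_law. norm ((section_mean x)\<^sup>2) \<le> norm (\<integral>v. (g (x * v))\<^sup>2 \<partial>exp_law)"
    using AE_section_square_integrable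
  proof eventually_elim
    case (elim x)
    then show ?case
      using Cauchy_Schwarz_integral[of "\<lambda>v. g (x * v)" exp_law "\<lambda>_. 1"] exp_law.prob_space
      by (auto simp: section_mean_def)
  qed
qed simp

lemma integrable_section_mean: "integrable exp_law section_mean"
  by (rule exp_law.square_integrable_imp_integrable[OF _ integrable_section_mean_square]) simp

lemma integrable_section_drift_square: "integrable exp_law (\<lambda>x. (section_drift x)\<^sup>2)"
proof (rule Bochner_Integration.integrable_bound[OF integrable_section_square])
  show "AE x in exp_law. norm ((section_drift x)\<^sup>2) \<le> norm (\<integral>v. (g (x * v))\<^sup>2 \<partial>exp_law)"
    using AE_section_square_integrable
  proof eventually_elim
    case (elim x)
    then show ?case
      using Cauchy_Schwarz_integral[of "\<lambda>v. g (x * v)" exp_law "\<lambda>v. 1 - v"] exp_law_centered_moments(3,4)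
      by (auto simp: section_drift_def power2_commute[of 1])
  qed
qed simp

lemma integrable_section_drift: "integrable exp_law section_drift"
  by (rule exp_law.square_integrable_imp_integrable[OF _ integrable_section_drift_square]) simp

lemma integrable_kernel_mult:
  assumes [measurable]: "h \<in> borel_measurable borel" and h: "integrable exp_law (\<lambda>v. (h v)\<^sup>2)"
  shows "integrable (exp_law \<Otimes>\<^sub>M exp_law) (\<lambda>z. g (fst z * snd z) * h (snd z))"
proof (rule integrable_mult_of_squares[OF _ _ square_integrable])
  show "integrable (exp_law \<Otimes>\<^sub>M exp_law) (\<lambda>z. (h (snd z))\<^sup>2)"
    using exp_law2.integrable_product(1)[OF _ h, of "\<lambda>_. 1"] by simp
qed auto

lemma integrable_section_weight: "integrable exp_law section_weight"
proof -
  have *: "((1 + v)\<^sup>2 * exp (v / 4))\<^sup>2 = (1 + v) ^ 4 * exp (v / 2)" for v :: real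
    by (simp add: power_mult_distrib flip: exp_of_nat_mult power_mult)
  have "integrable (exp_law \<Otimes>\<^sub>M exp_law) (\<lambda>z. \<bar>g (fst z * snd z) * ((1 + snd z)\<^sup>2 * exp (snd z / 4))\<bar>)"
    by (intro integrable_abs integrable_kernel_mult[where h = "\<lambda>v. (1 + v)\<^sup>2 * exp (v / 4)"])
       (simp_all add: * integrable_exp_law_power4_exp)
  from exp_law2.integrable_fst'[OF this] show ?thesis
    by (simp add: section_weight_def[abs_def] abs_mult)
qed

lemma section_weight_nonneg: "0 \<le> section_weight x"
  unfolding section_weight_def by (intro integral_nonneg_AE) auto

lemma kernel_mean_eq: "(\<integral>z. g (fst z * snd z) \<partial>(exp_law \<Otimes>\<^sub>M exp_law)) = kernel_mean"
  using exp_law2.integral_fst'[OF integrable_kernel_mult[of "\<lambda>_. 1"]]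
  by (simp add: kernel_mean_def section_mean_def)

lemma kernel_drift_eq: "(\<integral>z. g (fst z * snd z) * (1 - snd z) \<partial>(exp_law \<Otimes>\<^sub>M exp_law)) = (\<integral>x. section_drift x \<partial>exp_law)"
  using exp_law2.integral_fst'[OF integrable_kernel_mult[of "\<lambda>v. 1 - v"]] exp_law_centered_moments(3)
  by (simp add: section_drift_def power2_commute)

text \<open>Both sides come from E g(X Y) (1 - Y): integrating over Y first gives the drift,
  integrating over X first gives the mean of \<open>section_mean y * (1 - y)\<close>, by the
  symmetry of the product. Thus the derivative under dilation is minus a covariance.\<close>

lemma section_mean_drift: "(\<integral>x. section_mean x * (x - 1) \<partial>exp_law) = - (\<integral>x. section_drift x \<partial>exp_law)"
proof -
  have i: "integrable (exp_law \<Otimes>\<^sub>M exp_law) (\<lambda>z. g (fst z * snd z) * (1 - snd z))"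
    using exp_law_centered_moments(3) by (intro integrable_kernel_mult) (auto simp: power2_commute)
  have "(\<integral>x. section_drift x \<partial>exp_law) = (\<integral>z. g (fst z * snd z) * (1 - snd z) \<partial>(exp_law \<Otimes>\<^sub>M exp_law))"
    by (simp add: kernel_drift_eq)
  also have "\<dots> = (\<integral>y. \<integral>x. g (x * y) * (1 - y) \<partial>exp_law \<partial>exp_law)"
    using exp_law2.integral_snd[of "\<lambda>x y. g (x * y) * (1 - y)"] i by (simp add: case_prod_beta')
  also have "\<dots> = (\<integral>y. section_mean y * (1 - y) \<partial>exp_law)"
    by (simp add: section_mean_def mult.commute)
  finally show ?thesis by (simp add: right_diff_distrib flip: Bochner_Integration.integral_minus)
qed

lemma integrable_degenerate_part_square:
  "integrable (exp_law \<Otimes>\<^sub>M exp_law) (\<lambda>z. (degenerate_part (fst z) (snd z))\<^sup>2)"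
proof (rule Bochner_Integration.integrable_bound)
  show "integrable (exp_law \<Otimes>\<^sub>M exp_law) (\<lambda>z. 4 * ((g (fst z * snd z))\<^sup>2 + (section_mean (fst z))\<^sup>2 * 1
     + 1 * (section_mean (snd z))\<^sup>2 + kernel_mean\<^sup>2))"
    using exp_law2.integrable_product(1)[OF integrable_section_mean_square, of "\<lambda>_. 1"]
      exp_law2.integrable_product(1)[OF _ integrable_section_mean_square, of "\<lambda>_. 1"]
    by (intro integrable_mult_right Bochner_Integration.integrable_add square_integrable) auto
  \<comment> \<open>The difference of the two sides is the sum of the six squares supplied. The
    factors 1 give the terms the shape of products of functions of one variable.\<close>
  have *: "(a - b - c + d)\<^sup>2 \<le> 4 * (a\<^sup>2 + b\<^sup>2 * 1 + 1 * c\<^sup>2 + d\<^sup>2)" for a b c d :: real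
    using zero_le_power2[of "a + b"] zero_le_power2[of "a + c"] zero_le_power2[of "a - d"]
      zero_le_power2[of "b - c"] zero_le_power2[of "b + d"] zero_le_power2[of "c + d"]
    by (simp add: power2_eq_square algebra_simps)
  show "AE z in exp_law \<Otimes>\<^sub>M exp_law. norm ((degenerate_part (fst z) (snd z))\<^sup>2) \<le>
     norm (4 * ((g (fst z * snd z))\<^sup>2 + (section_mean (fst z))\<^sup>2 * 1 + 1 * (section_mean (snd z))\<^sup>2 + kernel_mean\<^sup>2))"
    unfolding degenerate_part_def using * by (intro AE_I2) (auto intro: order_trans[OF _ abs_ge_self])
qed (use measurable_degenerate_part in \<open>simp add: case_prod_beta' cong: measurable_cong_sets\<close>)

lemma degenerate_part_commute: "degenerate_part x y = degenerate_part y x"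
  by (simp add: degenerate_part_def mult.commute)

lemma AE_degenerate_part:
  "AE x in exp_law. integrable exp_law (degenerate_part x) \<and> (\<integral>y. degenerate_part x y \<partial>exp_law) = 0"
  using AE_section_square_integrable
proof eventually_elim
  case (elim x)
  have "degenerate_part x = (\<lambda>y. g (x * y) - section_mean x - section_mean y + kernel_mean)"
    by (simp add: degenerate_part_def fun_eq_iff)
  then show ?case
    using integrable_section(1)[OF elim] integrable_section_mean exp_law.prob_space
    by (simp add: section_mean_def[of x, symmetric] kernel_mean_def[symmetric])
qed

text \<open>Substituting \<theta> v for v undoes the dilation inside \<open>g\<close>, so that
  \<open>g\<close> is evaluated at the same points x v for every \<theta> and the whole dependence
  on \<theta> sits in a smooth factor.\<close>

lemma section_mean_dilation:
  assumes t: "0 < \<theta>"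
  shows "section_mean (x / \<theta>) = (\<integral>v. g (x * v) * (\<theta> * exp (- (\<theta> - 1) * v)) \<partial>exp_law)"
proof -
  have "section_mean (x / \<theta>) = (\<integral>v. exponential_density 1 v * g (x / \<theta> * v) \<partial>lborel)"
    unfolding section_mean_def exp_law_def by (subst integral_density) auto
  also have "\<dots> = \<bar>\<theta>\<bar> * (\<integral>v. exponential_density 1 (0 + \<theta> * v) * g (x / \<theta> * (0 + \<theta> * v)) \<partial>lborel)"
    using t lborel_integral_real_affine[of \<theta> "\<lambda>v. exponential_density 1 v * g (x / \<theta> * v)" 0] by simp
  also have "\<dots> = (\<integral>v. \<theta> * (exponential_density 1 (\<theta> * v) * g (x * v)) \<partial>lborel)"
    using t by simp
  also have "\<dots> = (\<integral>v. exponential_density 1 v * (g (x * v) * (\<theta> * exp (- (\<theta> - 1) * v))) \<partial>lborel)"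
  proof (intro Bochner_Integration.integral_cong refl)
    fix v
    have "exp (- (\<theta> * v)) = exp (- v) * exp (- (\<theta> - 1) * v)"
      by (simp add: algebra_simps flip: exp_add)
    then show "\<theta> * (exponential_density 1 (\<theta> * v) * g (x * v)) =
       exponential_density 1 v * (g (x * v) * (\<theta> * exp (- (\<theta> - 1) * v)))"
      using t by (simp add: exponential_density_def mult_less_0_iff)
  qed
  also have "\<dots> = (\<integral>v. g (x * v) * (\<theta> * exp (- (\<theta> - 1) * v)) \<partial>exp_law)"
    unfolding exp_law_def by (subst integral_density) auto
  finally show ?thesis .
qed

text \<open>It is applied with the sample mean as \<theta>, for which x / \<theta> is the normalized
  variable.\<close>

lemma section_mean_expansion:
  assumes x: "integrable exp_law (\<lambda>v. (g (x * v))\<^sup>2)" and t: "\<bar>\<theta> - 1\<bar> \<le> 1 / 4"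
  shows "\<bar>section_mean (x / \<theta>) - section_mean x - (\<theta> - 1) * section_drift x\<bar> \<le> (\<theta> - 1)\<^sup>2 * section_weight x"
proof -
  have t0: "0 < \<theta>" using t by linarith
  define T where "T v = \<theta> * exp (- (\<theta> - 1) * v)" for v
  define D where "D v = T v - 1 - (\<theta> - 1) * (1 - v)" for v
  have [measurable]: "T \<in> borel_measurable borel" "D \<in> borel_measurable borel"
    unfolding T_def D_def by measurable
  note i = integrable_section[OF x]
  have b: "AE v in exp_law. \<bar>g (x * v) * D v\<bar> \<le> (\<theta> - 1)\<^sup>2 * (\<bar>g (x * v)\<bar> * ((1 + v)\<^sup>2 * exp (v / 4)))"
    using AE_exp_law_pos
  proof eventually_elim
    case (elim v)
    have "\<bar>g (x * v)\<bar> * \<bar>D v\<bar> \<le> \<bar>g (x * v)\<bar> * ((\<theta> - 1)\<^sup>2 * ((1 + v)\<^sup>2 * exp (v / 4)))"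
      unfolding D_def T_def using elim t by (intro mult_left_mono exponential_tilt_expansion) auto
    then show ?case by (simp add: abs_mult ac_simps)
  qed
  have iD: "integrable exp_law (\<lambda>v. g (x * v) * D v)"
    by (rule Bochner_Integration.integrable_bound[OF integrable_mult_right[OF i(3), of "(\<theta> - 1)\<^sup>2"]])
       (use b in \<open>auto elim!: eventually_mono simp: abs_mult\<close>)
  have "section_mean (x / \<theta>) = (\<integral>v. g (x * v) * D v + g (x * v) + (\<theta> - 1) * (g (x * v) * (1 - v)) \<partial>exp_law)"
    unfolding section_mean_dilation[OF t0]
    by (intro Bochner_Integration.integral_cong refl) (simp add: D_def T_def algebra_simps)
  also have "\<dots> = (\<integral>v. g (x * v) * D v \<partial>exp_law) + section_mean x + (\<theta> - 1) * section_drift x"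
    using i iD by (simp add: section_mean_def section_drift_def)
  finally have "\<bar>section_mean (x / \<theta>) - section_mean x - (\<theta> - 1) * section_drift x\<bar> = \<bar>\<integral>v. g (x * v) * D v \<partial>exp_law\<bar>"
    by simp
  also have "\<dots> \<le> (\<integral>v. \<bar>g (x * v) * D v\<bar> \<partial>exp_law)" by (rule integral_abs_bound)
  also have "\<dots> \<le> (\<integral>v. (\<theta> - 1)\<^sup>2 * (\<bar>g (x * v)\<bar> * ((1 + v)\<^sup>2 * exp (v / 4))) \<partial>exp_law)"
    using b iD i(3) by (intro integral_mono_AE) auto
  finally show ?thesis by (simp add: section_weight_def)
qed

end

section \<open>Linearization of the normalized sample\<close>

context prob_space begin

text \<open>
  \<open>E min(1, \<bar>U\<^sub>n\<bar>) \<longlonglongrightarrow> 0\<close> is used as a subadditive substitute for convergence to 0 in probability.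
\<close>

lemma truncated_mean_add_tendsto:
  fixes U V :: "nat \<Rightarrow> 'a \<Rightarrow> real"
  assumes [measurable]: "\<And>n. U n \<in> borel_measurable M" "\<And>n. V n \<in> borel_measurable M"
    and U: "(\<lambda>n. \<integral>\<omega>. min 1 \<bar>U n \<omega>\<bar> \<partial>M) \<longlonglongrightarrow> 0" and V: "(\<lambda>n. \<integral>\<omega>. min 1 \<bar>V n \<omega>\<bar> \<partial>M) \<longlonglongrightarrow> 0"
  shows "(\<lambda>n. \<integral>\<omega>. min 1 \<bar>U n \<omega> + V n \<omega>\<bar> \<partial>M) \<longlonglongrightarrow> 0"
proof (rule tendsto_sandwich[where f = "\<lambda>_. 0"])
  have i: "integrable M (\<lambda>\<omega>. min 1 \<bar>Z \<omega>\<bar>)" if [measurable]: "Z \<in> borel_measurable M" for Z :: "'a \<Rightarrow> real"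
    by (rule integrable_const_bound[where B = 1]) auto
  show "\<forall>\<^sub>F n in sequentially. (\<integral>\<omega>. min 1 \<bar>U n \<omega> + V n \<omega>\<bar> \<partial>M) \<le>
     (\<integral>\<omega>. min 1 \<bar>U n \<omega>\<bar> \<partial>M) + (\<integral>\<omega>. min 1 \<bar>V n \<omega>\<bar> \<partial>M)"
  proof (intro always_eventually allI)
    fix n
    have "(\<integral>\<omega>. min 1 \<bar>U n \<omega> + V n \<omega>\<bar> \<partial>M) \<le> (\<integral>\<omega>. min 1 \<bar>U n \<omega>\<bar> + min 1 \<bar>V n \<omega>\<bar> \<partial>M)"
      using i by (intro integral_mono Bochner_Integration.integrable_add) auto
    also have "\<dots> = (\<integral>\<omega>. min 1 \<bar>U n \<omega>\<bar> \<partial>M) + (\<integral>\<omega>. min 1 \<bar>V n \<omega>\<bar> \<partial>M)"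
      using i by (intro Bochner_Integration.integral_add) auto
    finally show "(\<integral>\<omega>. min 1 \<bar>U n \<omega> + V n \<omega>\<bar> \<partial>M) \<le> (\<integral>\<omega>. min 1 \<bar>U n \<omega>\<bar> \<partial>M) + (\<integral>\<omega>. min 1 \<bar>V n \<omega>\<bar> \<partial>M)" .
  qed
  show "(\<lambda>n. (\<integral>\<omega>. min 1 \<bar>U n \<omega>\<bar> \<partial>M) + (\<integral>\<omega>. min 1 \<bar>V n \<omega>\<bar> \<partial>M)) \<longlonglongrightarrow> 0"
    using tendsto_add[OF U V] by simp
qed (auto intro!: always_eventually integral_nonneg_AE)

end

context exponential_sample begin

lemma AE_X:
  assumes "i \<ge> 1" "AE x in exp_law. P x"
  shows "AE \<omega> in M. P (X i \<omega>)"
  using assms(2) unfolding distr_X[OF assms(1), symmetric]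
  by (rule AE_distrD[OF measurable_X[OF assms(1)]])

lemma integrable_X: "i \<ge> 1 \<Longrightarrow> integrable exp_law f \<Longrightarrow> integrable M (\<lambda>\<omega>. f (X i \<omega>))"
  for f :: "real \<Rightarrow> real"
  using integrable_distr[of "X i" M borel f] by (simp add: distr_X)

lemma integral_X: "i \<ge> 1 \<Longrightarrow> f \<in> borel_measurable borel \<Longrightarrow> (\<integral>\<omega>. f (X i \<omega>) \<partial>M) = (\<integral>x. f x \<partial>exp_law)"
  for f :: "real \<Rightarrow> real"
  using integral_distr[of "X i" M borel f] by (simp add: distr_X)

lemma sum_square_X:
  assumes [measurable]: "f \<in> borel_measurable borel"
    and f2: "integrable exp_law (\<lambda>x. (f x)\<^sup>2)" and f0: "(\<integral>x. f x \<partial>exp_law) = (0 :: real)"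
  shows "integrable M (\<lambda>\<omega>. (\<Sum>i=1..n. f (X i \<omega>))\<^sup>2)"
    and "(\<integral>\<omega>. (\<Sum>i=1..n. f (X i \<omega>))\<^sup>2 \<partial>M) = real n * (\<integral>x. (f x)\<^sup>2 \<partial>exp_law)"
proof -
  have fi: "integrable exp_law f" by (rule exp_law.square_integrable_imp_integrable[OF _ f2]) simp
  have sq: "(\<Sum>i=1..n. f (X i \<omega>))\<^sup>2 = (\<Sum>i=1..n. \<Sum>k=1..n. f (X i \<omega>) * f (X k \<omega>))" for \<omega>
    by (simp add: power2_eq_square sum_product)
  have int: "integrable M (\<lambda>\<omega>. f (X i \<omega>) * f (X k \<omega>))" if "i \<in> {1..n}" "k \<in> {1..n}" for i k
    using that f2 by (intro integrable_mult_of_squares) (auto intro: integrable_X)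
  have val: "(\<integral>\<omega>. f (X i \<omega>) * f (X k \<omega>) \<partial>M) = (if i = k then (\<integral>x. (f x)\<^sup>2 \<partial>exp_law) else 0)"
    if "i \<in> {1..n}" "k \<in> {1..n}" for i k
  proof (cases "i = k")
    case True
    then show ?thesis using integral_X[of k "\<lambda>x. (f x)\<^sup>2"] that by (simp add: power2_eq_square)
  next
    case False
    have "indep_vars (\<lambda>_. borel) X {i, k}"
      by (rule indep_vars_subset[OF indep]) (use that in auto)
    \<comment> \<open>A one-term sum turns \<open>indep_vars_sum\<close> into independence of two
      members.\<close>
    then have "indep_var borel (X i) borel (X k)"
      using indep_vars_sum[of "{k}" i X] False by simp
    then have "indep_var borel (f \<circ> X i) borel (f \<circ> X k)"
      by (rule indep_var_compose) simp_all
    then have "(\<integral>\<omega>. f (X i \<omega>) * f (X k \<omega>) \<partial>M) = (\<integral>\<omega>. f (X i \<omega>) \<partial>M) * (\<integral>\<omega>. f (X k \<omega>) \<partial>M)"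
      using that fi by (subst indep_var_lebesgue_integral[symmetric]) (auto simp: comp_def intro: integrable_X)
    then show ?thesis using False that f0 by (simp add: integral_X)
  qed
  show "integrable M (\<lambda>\<omega>. (\<Sum>i=1..n. f (X i \<omega>))\<^sup>2)"
    unfolding sq using int by (intro Bochner_Integration.integrable_sum) auto
  have "(\<integral>\<omega>. (\<Sum>i=1..n. f (X i \<omega>))\<^sup>2 \<partial>M) = (\<Sum>i=1..n. \<Sum>k=1..n. (\<integral>\<omega>. f (X i \<omega>) * f (X k \<omega>) \<partial>M))"
    unfolding sq using int by (subst Bochner_Integration.integral_sum, auto)+
  also have "\<dots> = (\<Sum>i=1..n. \<Sum>k=1..n. if i = k then (\<integral>x. (f x)\<^sup>2 \<partial>exp_law) else 0)"
    using val by (intro sum.cong refl) auto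
  finally show "(\<integral>\<omega>. (\<Sum>i=1..n. f (X i \<omega>))\<^sup>2 \<partial>M) = real n * (\<integral>x. (f x)\<^sup>2 \<partial>exp_law)"
    by (simp add: sum.delta')
qed

text \<open>The marginal density bound makes the law of a normalized variable absolutely continuous
  with respect to \<open>exp_law\<close>, so null sets pull back to null sets. Passing to a
  measurable null set \<open>N\<close> allows an arbitrary \<open>P\<close>.\<close>

lemma AE_normalized:
  assumes i: "i \<in> {1..n}" and n: "n \<ge> 3" and P: "AE x in exp_law. P x"
  shows "AE \<omega> in M. P (normalized X n i \<omega>)"
proof -
  obtain N where N: "{x. \<not> P x} \<subseteq> N" "N \<in> null_sets exp_law"
    using P by (auto simp: eventually_ae_filter)
  have [measurable]: "N \<in> sets borel" using N(2) by auto
  have [measurable]: "normalized X n i \<in> borel_measurable M" using i by auto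
  have "(\<integral>\<^sup>+\<omega>. indicator N (normalized X n i \<omega>) \<partial>M) \<le> ennreal (exp 3) * (\<integral>\<^sup>+u. indicator N u \<partial>exp_law)"
    by (rule nn_integral_normalized_le[OF i n]) simp
  also have "\<dots> = 0" using N(2) by auto
  finally have "AE \<omega> in M. (indicator N (normalized X n i \<omega>) :: ennreal) = 0"
    by (subst nn_integral_0_iff_AE[symmetric]) auto
  then show ?thesis
    by eventually_elim (use N(1) in \<open>auto simp: indicator_def split: if_splits\<close>)
qed

end

text \<open>The quadratic remainder contains p^2 * W, whose factors are integrable but dependent, so
  the product need not be integrable. Since min 1 z \<le> sqrt z, it can be replaced by a geometric
  mean, and the arithmetic mean then needs only first moments of p^2 and W. A gain of n^(-1/4)
  remains.\<close>

lemma min_one_le_half_sum: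
  fixes p W n :: real
  assumes "0 \<le> W" "0 < n"
  shows "min 1 (p\<^sup>2 / n * W / sqrt n) \<le> (p\<^sup>2 + W / n) / (2 * sqrt (sqrt n))"
proof -
  define z where "z = p\<^sup>2 / n * W / sqrt n"
  have z0: "0 \<le> z" using assms by (simp add: z_def)
  have "min 1 z \<le> sqrt z"
  proof (cases "z \<le> 1")
    case True
    then have "z * z \<le> z * 1" using z0 by (intro mult_left_mono) auto
    then have "z \<le> sqrt z" using z0 by (intro real_le_rsqrt) (simp add: power2_eq_square)
    then show ?thesis by simp
  next
    case False
    then show ?thesis by simp
  qed
  also have "sqrt z = \<bar>p\<bar> * sqrt (W / n) / sqrt (sqrt n)"
    by (simp add: z_def real_sqrt_mult real_sqrt_divide)
  also have "\<dots> \<le> ((p\<^sup>2 + W / n) / 2) / sqrt (sqrt n)"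
    using assms sum_squares_bound[of "\<bar>p\<bar>" "sqrt (W / n)"] by (intro divide_right_mono) auto
  finally show ?thesis by (simp add: z_def)
qed

context product_kernel begin

definition drift :: real where
  "drift = (\<integral>x. section_drift x \<partial>exp_law)"

text \<open>Since \<open>drift\<close> equals -c, as \<open>covariance_kernel_X\<close> shows, this
  is A x - \<mu> - c (x - 1).\<close>

definition linear_score :: "real \<Rightarrow> real" where
  "linear_score x = section_mean x - kernel_mean + drift * (x - 1)"

lemma measurable_linear_score [measurable]: "linear_score \<in> borel_measurable borel"
  unfolding linear_score_def[abs_def] by measurable

end

locale sample_kernel = exponential_sample M X + product_kernel g
  for M :: "'a measure" and X :: "nat \<Rightarrow> 'a \<Rightarrow> real" and g :: "real \<Rightarrow> real"
begin

definition linearization_error :: "nat \<Rightarrow> 'a \<Rightarrow> real" where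
  "linearization_error n \<omega> =
     (\<Sum>i=1..n. section_mean (normalized X n i \<omega>) - kernel_mean) / sqrt n
     - (\<Sum>i=1..n. linear_score (X i \<omega>)) / sqrt n"

lemma measurable_linearization_error [measurable]: "linearization_error n \<in> borel_measurable M"
proof -
  have [measurable]: "X i \<in> borel_measurable M" "normalized X n i \<in> borel_measurable M" if "i \<in> {1..n}" for i
    using that by auto
  show ?thesis unfolding linearization_error_def[abs_def] by measurable
qed

lemma linearization_error_le:
  assumes n: "n \<ge> 1"
  defines "p \<equiv> \<lambda>\<omega>. (\<Sum>i=1..n. X i \<omega> - 1) / sqrt n"
    and "q \<equiv> \<lambda>\<omega>. (\<Sum>i=1..n. section_drift (X i \<omega>) - drift) / sqrt n"
    and "W \<equiv> \<lambda>\<omega>. \<Sum>i=1..n. section_weight (X i \<omega>)"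
  shows "AE \<omega> in M. min 1 \<bar>linearization_error n \<omega>\<bar> \<le>
     16 * ((p \<omega>)\<^sup>2 / n) + ((p \<omega>)\<^sup>2 + W \<omega> / n) / (2 * sqrt (sqrt n)) + ((p \<omega>)\<^sup>2 + (q \<omega>)\<^sup>2) / (2 * sqrt n)"
proof -
  have "AE \<omega> in M. \<forall>i\<in>{1..n}. integrable exp_law (\<lambda>v. (g (X i \<omega> * v))\<^sup>2)"
    by (intro AE_finite_allI AE_X[OF _ AE_section_square_integrable]) auto
  then show ?thesis
  proof eventually_elim
    case (elim \<omega>)
    define \<delta> where "\<delta> = sample_mean X n \<omega> - 1"
    have sn: "sqrt n > 0" "sqrt n * sqrt n = real n" using n by auto
    have sumd: "(\<Sum>i=1..n. X i \<omega> - 1) = n * \<delta>"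
      using n by (simp add: \<delta>_def sample_mean_def sum_subtractf algebra_simps)
    have p: "p \<omega> = sqrt n * \<delta>"
      unfolding p_def sumd using sn by (metis mult.assoc nonzero_mult_div_cancel_left order_less_irrefl)
    have p2: "(p \<omega>)\<^sup>2 = n * \<delta>\<^sup>2" using p n by (simp add: power_mult_distrib)
    have W0: "0 \<le> W \<omega>" unfolding W_def by (intro sum_nonneg section_weight_nonneg)
    have nonneg: "0 \<le> ((p \<omega>)\<^sup>2 + W \<omega> / n) / (2 * sqrt (sqrt n))" "0 \<le> ((p \<omega>)\<^sup>2 + (q \<omega>)\<^sup>2) / (2 * sqrt n)"
      using W0 by auto
    show ?case
    proof (cases "\<bar>\<delta>\<bar> \<le> 1 / 4")
      case False
      then have "(1 / 4)\<^sup>2 \<le> \<bar>\<delta>\<bar>\<^sup>2" by (intro power_mono) auto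
      moreover have "(p \<omega>)\<^sup>2 / n = \<delta>\<^sup>2" using n by (simp add: p2)
      ultimately have "1 \<le> 16 * ((p \<omega>)\<^sup>2 / n)" by (simp add: power2_eq_square)
      then show ?thesis using nonneg by linarith
    next
      case True
      define R where "R = (\<Sum>i=1..n. section_mean (normalized X n i \<omega>) - section_mean (X i \<omega>) - \<delta> * section_drift (X i \<omega>))"
      \<comment> \<open>The first-order term \<delta> * section_drift is split into its centered
        part and \<delta> * drift. Summed over i, the latter is exactly the correction built into
        \<open>linear_score\<close>.\<close>
      have "(\<Sum>i=1..n. section_mean (normalized X n i \<omega>) - kernel_mean) - (\<Sum>i=1..n. linear_score (X i \<omega>)) =
          (\<Sum>i=1..n. (section_mean (normalized X n i \<omega>) - section_mean (X i \<omega>) - \<delta> * section_drift (X i \<omega>))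
            + \<delta> * (section_drift (X i \<omega>) - drift) + (\<delta> * drift - drift * (X i \<omega> - 1)))"
        unfolding sum_subtractf[symmetric]
        by (intro sum.cong refl) (simp add: linear_score_def algebra_simps)
      also have "\<dots> = R + \<delta> * (\<Sum>i=1..n. section_drift (X i \<omega>) - drift) +
          (n * (\<delta> * drift) - drift * (\<Sum>i=1..n. X i \<omega> - 1))"
        by (simp add: R_def sum.distrib sum_subtractf sum_distrib_left right_diff_distrib)
      also have "n * (\<delta> * drift) - drift * (\<Sum>i=1..n. X i \<omega> - 1) = 0" unfolding sumd by simp
      finally have le: "linearization_error n \<omega> = R / sqrt n + \<delta> * q \<omega>"
        by (simp add: linearization_error_def q_def add_divide_distrib flip: diff_divide_distrib)
      have "\<bar>R\<bar> \<le> (\<Sum>i=1..n. \<delta>\<^sup>2 * section_weight (X i \<omega>))"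
        unfolding R_def
      proof (rule order_trans[OF sum_abs], rule sum_mono)
        fix i assume i: "i \<in> {1..n}"
        show "\<bar>section_mean (normalized X n i \<omega>) - section_mean (X i \<omega>) - \<delta> * section_drift (X i \<omega>)\<bar>
           \<le> \<delta>\<^sup>2 * section_weight (X i \<omega>)"
          unfolding normalized_def \<delta>_def using elim i True by (intro section_mean_expansion) (auto simp: \<delta>_def)
      qed
      then have R: "\<bar>R\<bar> / sqrt n \<le> (p \<omega>)\<^sup>2 / n * W \<omega> / sqrt n"
        using n by (intro divide_right_mono) (auto simp: p2 W_def sum_distrib_left)
      have "\<bar>\<delta> * q \<omega>\<bar> = \<bar>p \<omega>\<bar> * \<bar>q \<omega>\<bar> / sqrt n"
        using sn by (simp add: p abs_mult)
      also have "\<dots> \<le> (((p \<omega>)\<^sup>2 + (q \<omega>)\<^sup>2) / 2) / sqrt n"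
        using sum_squares_bound[of "\<bar>p \<omega>\<bar>" "\<bar>q \<omega>\<bar>"] by (intro divide_right_mono) auto
      finally have dq: "\<bar>\<delta> * q \<omega>\<bar> \<le> ((p \<omega>)\<^sup>2 + (q \<omega>)\<^sup>2) / (2 * sqrt n)" by simp
      have "\<bar>linearization_error n \<omega>\<bar> \<le> \<bar>R\<bar> / sqrt n + \<bar>\<delta> * q \<omega>\<bar>"
        unfolding le using abs_triangle_ineq[of "R / sqrt n" "\<delta> * q \<omega>"] by (simp add: abs_divide)
      then have "min 1 \<bar>linearization_error n \<omega>\<bar> \<le> min 1 ((p \<omega>)\<^sup>2 / n * W \<omega> / sqrt n) + \<bar>\<delta> * q \<omega>\<bar>"
        using R by linarith
      also have "\<dots> \<le> ((p \<omega>)\<^sup>2 + W \<omega> / n) / (2 * sqrt (sqrt n)) + ((p \<omega>)\<^sup>2 + (q \<omega>)\<^sup>2) / (2 * sqrt n)"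
        using n W0 dq by (intro add_mono min_one_le_half_sum) auto
      also have "\<dots> \<le> 16 * ((p \<omega>)\<^sup>2 / n) + \<dots>" by simp
      finally show ?thesis by simp
    qed
  qed
qed

text \<open>The expectations of p^2 and q^2 do not depend on n and that of W is linear in n, so the
  pointwise bound decays like n^(-1/4).\<close>

lemma linearization_error_tendsto:
  "(\<lambda>n. \<integral>\<omega>. min 1 \<bar>linearization_error n \<omega>\<bar> \<partial>M) \<longlonglongrightarrow> 0"
proof (rule tendsto_sandwich[where f = "\<lambda>_. 0"])
  define B where "B = (\<integral>x. (section_drift x - drift)\<^sup>2 \<partial>exp_law)"
  define m where "m = (\<integral>x. section_weight x \<partial>exp_law)"
  have dc: "integrable exp_law (\<lambda>x. (section_drift x - drift)\<^sup>2)" "(\<integral>x. section_drift x - drift \<partial>exp_law) = 0"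
  proof -
    have "integrable exp_law (\<lambda>x. (section_drift x)\<^sup>2 - 2 * drift * section_drift x + drift\<^sup>2)"
      using integrable_section_drift integrable_section_drift_square by auto
    then show "integrable exp_law (\<lambda>x. (section_drift x - drift)\<^sup>2)"
      by (simp add: power2_eq_square algebra_simps)
    show "(\<integral>x. section_drift x - drift \<partial>exp_law) = 0"
      using integrable_section_drift exp_law.prob_space by (simp add: drift_def)
  qed
  show "\<forall>\<^sub>F n in sequentially. (\<integral>\<omega>. min 1 \<bar>linearization_error n \<omega>\<bar> \<partial>M) \<le>
      16 * (1 / n) + (1 + m) / (2 * sqrt (sqrt n)) + (1 + B) / (2 * sqrt n)"
  proof (rule eventually_sequentiallyI[of 1])
    fix n :: nat assume n: "n \<ge> 1"
    define p q W where "p = (\<lambda>\<omega>. (\<Sum>i=1..n. X i \<omega> - 1) / sqrt n)"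
      and "q = (\<lambda>\<omega>. (\<Sum>i=1..n. section_drift (X i \<omega>) - drift) / sqrt n)"
      and "W = (\<lambda>\<omega>. \<Sum>i=1..n. section_weight (X i \<omega>))"
    have p: "integrable M (\<lambda>\<omega>. (p \<omega>)\<^sup>2)" "(\<integral>\<omega>. (p \<omega>)\<^sup>2 \<partial>M) = 1"
      using sum_square_X[of "\<lambda>x. x - 1" n] exp_law_centered_moments n by (auto simp: p_def power_divide)
    have q: "integrable M (\<lambda>\<omega>. (q \<omega>)\<^sup>2)" "(\<integral>\<omega>. (q \<omega>)\<^sup>2 \<partial>M) = B"
      using sum_square_X[of "\<lambda>x. section_drift x - drift" n] dc n by (auto simp: q_def power_divide B_def)
    have W: "integrable M W" "(\<integral>\<omega>. W \<omega> \<partial>M) = n * m"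
    proof -
      have i: "integrable M (\<lambda>\<omega>. section_weight (X i \<omega>))" if "i \<in> {1..n}" for i
        using that by (intro integrable_X integrable_section_weight) auto
      then show "integrable M W" unfolding W_def by (intro Bochner_Integration.integrable_sum)
      show "(\<integral>\<omega>. W \<omega> \<partial>M) = n * m"
        unfolding W_def using i by (subst Bochner_Integration.integral_sum) (auto simp: integral_X m_def)
    qed
    let ?Z = "\<lambda>\<omega>. 16 * ((p \<omega>)\<^sup>2 / n) + ((p \<omega>)\<^sup>2 + W \<omega> / n) / (2 * sqrt (sqrt n)) + ((p \<omega>)\<^sup>2 + (q \<omega>)\<^sup>2) / (2 * sqrt n)"
    have iZ: "integrable M ?Z" using p q W by auto
    have le: "AE \<omega> in M. min 1 \<bar>linearization_error n \<omega>\<bar> \<le> ?Z \<omega>"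
      unfolding p_def q_def W_def by (rule linearization_error_le[OF n])
    have "(\<integral>\<omega>. min 1 \<bar>linearization_error n \<omega>\<bar> \<partial>M) \<le> (\<integral>\<omega>. ?Z \<omega> \<partial>M)"
      using le by (intro integral_mono_AE iZ integrable_const_bound[where B = 1]) auto
    also have "\<dots> = 16 * (1 / n) + (1 + m) / (2 * sqrt (sqrt n)) + (1 + B) / (2 * sqrt n)"
      using p q W n by simp
    finally show "(\<integral>\<omega>. min 1 \<bar>linearization_error n \<omega>\<bar> \<partial>M) \<le>
      16 * (1 / n) + (1 + m) / (2 * sqrt (sqrt n)) + (1 + B) / (2 * sqrt n)" .
  qed
  have s: "filterlim (\<lambda>n. sqrt (real n)) at_top sequentially"
    by (rule filterlim_compose[OF sqrt_at_top filterlim_real_sequentially])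
  have ss: "filterlim (\<lambda>n. sqrt (sqrt (real n))) at_top sequentially"
    by (rule filterlim_compose[OF sqrt_at_top s])
  have z: "(\<lambda>n. K / (2 * f n)) \<longlonglongrightarrow> 0" if "filterlim f at_top sequentially" for K :: real and f
    by (intro real_tendsto_divide_at_top[OF tendsto_const] filterlim_tendsto_pos_mult_at_top[OF tendsto_const _ that]) simp
  show "(\<lambda>n. 16 * (1 / real n) + (1 + m) / (2 * sqrt (sqrt n)) + (1 + B) / (2 * sqrt n)) \<longlonglongrightarrow> 0"
    by (intro tendsto_add_zero tendsto_mult_right_zero lim_1_over_n z s ss)
qed (auto intro!: always_eventually integral_nonneg_AE)

end

section \<open>Two independent samples\<close>

locale two_exponential_samples = prob_space +
  fixes X Y :: "nat \<Rightarrow> 'a \<Rightarrow> real"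
  assumes joint_indep: "indep_vars (\<lambda>_. borel) (case_sum X Y) ({1..} <+> {1..})"
    and exponential_X: "\<And>i. i \<ge> 1 \<Longrightarrow> distributed M lborel (X i) (exponential_density 1)"
    and exponential_Y: "\<And>j. j \<ge> 1 \<Longrightarrow> distributed M lborel (Y j) (exponential_density 1)"
begin

lemma indep_vars_X: "indep_vars (\<lambda>_. borel) X {1..}"
proof -
  have "indep_vars (\<lambda>_. borel) (\<lambda>i \<omega>. (\<lambda>h. h (Inl i)) (\<lambda>k\<in>{Inl i}. case_sum X Y k \<omega>)) {1..}"
    by (rule indep_vars_compose2[OF indep_vars_restrict[OF joint_indep]]) (auto simp: disjoint_family_on_def)
  then show ?thesis by simp
qed

lemma indep_vars_Y: "indep_vars (\<lambda>_. borel) Y {1..}"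
proof -
  have "indep_vars (\<lambda>_. borel) (\<lambda>i \<omega>. (\<lambda>h. h (Inr i)) (\<lambda>k\<in>{Inr i}. case_sum X Y k \<omega>)) {1..}"
    by (rule indep_vars_compose2[OF indep_vars_restrict[OF joint_indep]]) (auto simp: disjoint_family_on_def)
  then show ?thesis by simp
qed

sublocale X: exponential_sample M X
  by unfold_locales (rule indep_vars_X, rule exponential_X)

sublocale Y: exponential_sample M Y
  by unfold_locales (rule indep_vars_Y, rule exponential_Y)

text \<open>A whole normalized sample is one element of a finite product space, since its
  coordinates share a sample mean and only the two complete vectors are independent of each
  other.\<close>

definition normalized_vector :: "(nat \<Rightarrow> 'a \<Rightarrow> real) \<Rightarrow> nat \<Rightarrow> 'a \<Rightarrow> nat \<Rightarrow> real" where
  "normalized_vector Z n \<omega> = (\<lambda>i\<in>{1..n}. normalized Z n i \<omega>)"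

lemma measurable_normalized_vector [measurable]:
  "normalized_vector X n \<in> measurable M (PiM {1..n} (\<lambda>_. borel))"
  "normalized_vector Y n \<in> measurable M (PiM {1..n} (\<lambda>_. borel))"
  unfolding normalized_vector_def[abs_def] by (auto intro!: measurable_restrict)

lemma distr_normalized_vectors:
  "distr M (PiM {1..n} (\<lambda>_. borel) \<Otimes>\<^sub>M PiM {1..n} (\<lambda>_. borel)) (\<lambda>\<omega>. (normalized_vector Y n \<omega>, normalized_vector X n \<omega>)) =
   distr M (PiM {1..n} (\<lambda>_. borel)) (normalized_vector Y n) \<Otimes>\<^sub>M distr M (PiM {1..n} (\<lambda>_. borel)) (normalized_vector X n)"
proof -
  \<comment> \<open>The normalization is recomputed from the raw block alone, which exhibits each
    vector as a function of its own variables.\<close>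
  define f where "f h = (\<lambda>i\<in>{1..n}. h (Inr i) / ((\<Sum>j=1..n. h (Inr j)) / real n))" for h :: "nat + nat \<Rightarrow> real"
  define f' where "f' h = (\<lambda>i\<in>{1..n}. h (Inl i) / ((\<Sum>j=1..n. h (Inl j)) / real n))" for h :: "nat + nat \<Rightarrow> real"
  have f: "f \<in> measurable (PiM (Inr ` {1..n}) (\<lambda>_. borel)) (PiM {1..n} (\<lambda>_. borel))"
    unfolding f_def[abs_def] by (intro measurable_restrict) simp
  have f': "f' \<in> measurable (PiM (Inl ` {1..n}) (\<lambda>_. borel)) (PiM {1..n} (\<lambda>_. borel))"
    unfolding f'_def[abs_def] by (intro measurable_restrict) simp
  have "f (\<lambda>k\<in>Inr ` {1..n}. case_sum X Y k \<omega>) = normalized_vector Y n \<omega>"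
    "f' (\<lambda>k\<in>Inl ` {1..n}. case_sum X Y k \<omega>) = normalized_vector X n \<omega>" for \<omega>
    by (auto simp: f_def f'_def normalized_vector_def normalized_def sample_mean_def fun_eq_iff)
  moreover have "Inr ` {1..n} \<inter> Inl ` {1..n} = ({} :: (nat + nat) set)"
    "Inr ` {1..n} \<subseteq> {1 :: nat..} <+> {1 :: nat..}" "Inl ` {1..n} \<subseteq> {1 :: nat..} <+> {1 :: nat..}"
    by auto
  note indep_vars_distr_pair[OF joint_indep this f f']
  ultimately show ?thesis by simp
qed

lemma nn_integral_normalized_vectors:
  assumes [measurable]: "F \<in> borel_measurable (PiM {1..n} (\<lambda>_. borel) \<Otimes>\<^sub>M PiM {1..n} (\<lambda>_. borel))"
  shows "(\<integral>\<^sup>+\<omega>. F (normalized_vector Y n \<omega>, normalized_vector X n \<omega>) \<partial>M) =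
    (\<integral>\<^sup>+\<omega>'. \<integral>\<^sup>+\<omega>. F (normalized_vector Y n \<omega>', normalized_vector X n \<omega>) \<partial>M \<partial>M)"
proof -
  let ?P = "PiM {1..n} (\<lambda>_. borel) :: (nat \<Rightarrow> real) measure"
  interpret PX: prob_space "distr M ?P (normalized_vector X n)" by (rule prob_space_distr) measurable
  have "(\<integral>\<^sup>+\<omega>. F (normalized_vector Y n \<omega>, normalized_vector X n \<omega>) \<partial>M) =
     (\<integral>\<^sup>+z. F z \<partial>distr M (?P \<Otimes>\<^sub>M ?P) (\<lambda>\<omega>. (normalized_vector Y n \<omega>, normalized_vector X n \<omega>)))"
    by (subst nn_integral_distr) measurable
  also have "\<dots> = (\<integral>\<^sup>+y. \<integral>\<^sup>+x. F (y, x) \<partial>distr M ?P (normalized_vector X n) \<partial>distr M ?P (normalized_vector Y n))"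
    unfolding distr_normalized_vectors by (subst PX.nn_integral_fst[symmetric]) measurable
  also have "\<dots> = (\<integral>\<^sup>+\<omega>'. \<integral>\<^sup>+x. F (normalized_vector Y n \<omega>', x) \<partial>distr M ?P (normalized_vector X n) \<partial>M)"
    by (subst nn_integral_distr) measurable
  also have "\<dots> = (\<integral>\<^sup>+\<omega>'. \<integral>\<^sup>+\<omega>. F (normalized_vector Y n \<omega>', normalized_vector X n \<omega>) \<partial>M \<partial>M)"
    by (intro nn_integral_cong nn_integral_distr) measurable
  finally show ?thesis .
qed

text \<open>With the Y-sample frozen, the inner sum over j is a function of x of mean zero, and the
  one-sample bound applies; after Fubini it applies again to \<open>r x\<close> for fixed x. The
  one-sample bound asks for the mean only where the square is integrable, so no square integrability
  of \<open>r\<close> is assumed here.\<close>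

lemma nn_integral_degenerate_double_sum_le:
  assumes n: "n \<ge> 3" and r: "(\<lambda>(x, y). r x y) \<in> borel_measurable (borel \<Otimes>\<^sub>M borel)"
    and rx: "AE x in exp_law. integrable exp_law (r x) \<and> (\<integral>y. r x y \<partial>exp_law) = 0"
    and ry: "AE y in exp_law. integrable exp_law (\<lambda>x. r x y) \<and> (\<integral>x. r x y \<partial>exp_law) = 0"
  shows "(\<integral>\<^sup>+\<omega>. ennreal ((\<Sum>i=1..n. \<Sum>j=1..n. r (normalized X n i \<omega>) (normalized Y n j \<omega>))\<^sup>2) \<partial>M)
    \<le> ennreal (normalization_const * n) * (ennreal (normalization_const * n) *
        (\<integral>\<^sup>+x. \<integral>\<^sup>+y. ennreal ((r x y)\<^sup>2) \<partial>exp_law \<partial>exp_law))"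
proof -
  have r' [measurable (raw)]: "(\<lambda>z. r (a z) (b z)) \<in> borel_measurable N"
    if [measurable]: "a \<in> borel_measurable N" "b \<in> borel_measurable N"
    for N :: "'c measure" and a b
    using measurable_compose[OF measurable_Pair[OF that] r] by simp
  have mY: "normalized Y n j \<in> borel_measurable M" if "j \<in> {1..n}" for j using that by auto
  interpret PM: pair_sigma_finite exp_law M ..
  define F where "F z = ennreal ((\<Sum>i\<in>{1..n}. \<Sum>j\<in>{1..n}. r (snd z i) (fst z j))\<^sup>2)" for z :: "(nat \<Rightarrow> real) \<times> (nat \<Rightarrow> real)"
  let ?C = "ennreal (normalization_const * n)"
  let ?P = "PiM {1..n} (\<lambda>_. borel) :: (nat \<Rightarrow> real) measure"
  have co: "(\<lambda>z. snd z i) \<in> borel_measurable (?P \<Otimes>\<^sub>M ?P)" "(\<lambda>z. fst z i) \<in> borel_measurable (?P \<Otimes>\<^sub>M ?P)"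
    if "i \<in> {1..n}" for i
    using that by (auto intro!: measurable_compose[OF measurable_snd measurable_component_singleton]
      measurable_compose[OF measurable_fst measurable_component_singleton])
  have F: "F \<in> borel_measurable (?P \<Otimes>\<^sub>M ?P)"
    unfolding F_def[abs_def]
    by (intro measurable_compose[OF _ measurable_ennreal] borel_measurable_power borel_measurable_sum r' co)
  have FXY: "F (normalized_vector Y n \<omega>', normalized_vector X n \<omega>) =
     ennreal ((\<Sum>i=1..n. \<Sum>j=1..n. r (normalized X n i \<omega>) (normalized Y n j \<omega>'))\<^sup>2)" for \<omega> \<omega>'
    unfolding F_def fst_conv snd_conv
    by (intro arg_cong[where f = "\<lambda>s. ennreal (s\<^sup>2)"] sum.cong refl) (simp add: normalized_vector_def)
  \<comment> \<open>The condition on \<open>ry\<close> holds off an \<open>exp_law\<close>-null set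
    of y, which the normalized variables almost surely avoid.\<close>
  have "AE \<omega>' in M. \<forall>j\<in>{1..n}. integrable exp_law (\<lambda>x. r x (normalized Y n j \<omega>')) \<and>
      (\<integral>x. r x (normalized Y n j \<omega>') \<partial>exp_law) = 0"
    using ry n by (intro AE_finite_allI Y.AE_normalized) auto
  then have inner: "AE \<omega>' in M.
      (\<integral>\<^sup>+\<omega>. ennreal ((\<Sum>i=1..n. \<Sum>j=1..n. r (normalized X n i \<omega>) (normalized Y n j \<omega>'))\<^sup>2) \<partial>M)
     \<le> ?C * (\<integral>\<^sup>+x. ennreal ((\<Sum>j=1..n. r x (normalized Y n j \<omega>'))\<^sup>2) \<partial>exp_law)"
  proof eventually_elim
    case (elim \<omega>')
    show ?case
      by (rule X.nn_integral_normalized_sum_le[OF n]) (use elim in \<open>auto simp: Bochner_Integration.integral_sum\<close>)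
  qed
  have mm: "(\<lambda>z. ennreal ((\<Sum>j=1..n. r (fst z) (normalized Y n j (snd z)))\<^sup>2)) \<in> borel_measurable (exp_law \<Otimes>\<^sub>M M)"
    by (intro measurable_compose[OF _ measurable_ennreal] borel_measurable_power borel_measurable_sum r'
      measurable_compose[OF measurable_snd mY]) auto
  have mm2: "(\<lambda>z. ennreal ((\<Sum>j=1..n. r (snd z) (normalized Y n j (fst z)))\<^sup>2)) \<in> borel_measurable (M \<Otimes>\<^sub>M exp_law)"
    by (intro measurable_compose[OF _ measurable_ennreal] borel_measurable_power borel_measurable_sum r'
      measurable_compose[OF measurable_fst mY]) auto
  have "(\<integral>\<^sup>+\<omega>. ennreal ((\<Sum>i=1..n. \<Sum>j=1..n. r (normalized X n i \<omega>) (normalized Y n j \<omega>))\<^sup>2) \<partial>M) =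
     (\<integral>\<^sup>+\<omega>'. \<integral>\<^sup>+\<omega>. ennreal ((\<Sum>i=1..n. \<Sum>j=1..n. r (normalized X n i \<omega>) (normalized Y n j \<omega>'))\<^sup>2) \<partial>M \<partial>M)"
    using nn_integral_normalized_vectors[OF F] unfolding FXY .
  also have "\<dots> \<le> (\<integral>\<^sup>+\<omega>'. ?C * (\<integral>\<^sup>+x. ennreal ((\<Sum>j=1..n. r x (normalized Y n j \<omega>'))\<^sup>2) \<partial>exp_law) \<partial>M)"
    by (rule nn_integral_mono_AE[OF inner])
  also have "\<dots> = ?C * (\<integral>\<^sup>+\<omega>'. (\<integral>\<^sup>+x. ennreal ((\<Sum>j=1..n. r x (normalized Y n j \<omega>'))\<^sup>2) \<partial>exp_law) \<partial>M)"
    using mm2 by (intro nn_integral_cmult exp_law.borel_measurable_nn_integral) (simp add: case_prod_beta')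
  also have "\<dots> = ?C * (\<integral>\<^sup>+x. (\<integral>\<^sup>+\<omega>'. ennreal ((\<Sum>j=1..n. r x (normalized Y n j \<omega>'))\<^sup>2) \<partial>M) \<partial>exp_law)"
    using mm by (subst PM.Fubini') (auto simp: case_prod_beta')
  also have "\<dots> \<le> ?C * (\<integral>\<^sup>+x. ?C * (\<integral>\<^sup>+y. ennreal ((r x y)\<^sup>2) \<partial>exp_law) \<partial>exp_law)"
  proof (intro mult_left_mono nn_integral_mono_AE)
    show "AE x in exp_law. (\<integral>\<^sup>+\<omega>'. ennreal ((\<Sum>j=1..n. r x (normalized Y n j \<omega>'))\<^sup>2) \<partial>M) \<le>
      ?C * (\<integral>\<^sup>+y. ennreal ((r x y)\<^sup>2) \<partial>exp_law)"
      using rx by eventually_elim (rule Y.nn_integral_normalized_sum_le[OF n], auto)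
  qed simp
  also have "\<dots> = ?C * (?C * (\<integral>\<^sup>+x. \<integral>\<^sup>+y. ennreal ((r x y)\<^sup>2) \<partial>exp_law \<partial>exp_law))"
    by (subst nn_integral_cmult) auto
  finally show ?thesis .
qed

lemma distr_XY: "i \<ge> 1 \<Longrightarrow> j \<ge> 1 \<Longrightarrow> distr M (borel \<Otimes>\<^sub>M borel) (\<lambda>\<omega>. (X i \<omega>, Y j \<omega>)) = exp_law \<Otimes>\<^sub>M exp_law"
  using indep_vars_distr_pair[OF joint_indep, of "{Inl i}" "{Inr j}" "\<lambda>h. h (Inl i)" borel "\<lambda>h. h (Inr j)" borel]
  by (simp add: X.distr_X Y.distr_X Plus_def image_iff)

lemma distr_XYY:
  "distr M (borel \<Otimes>\<^sub>M (borel \<Otimes>\<^sub>M borel)) (\<lambda>\<omega>. (X 1 \<omega>, (Y 1 \<omega>, Y 2 \<omega>))) = exp_law \<Otimes>\<^sub>M (exp_law \<Otimes>\<^sub>M exp_law)"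
proof -
  have 1: "distr M (borel \<Otimes>\<^sub>M borel) (\<lambda>\<omega>. (Y 1 \<omega>, Y 2 \<omega>)) = exp_law \<Otimes>\<^sub>M exp_law"
    using indep_vars_distr_pair[OF joint_indep, of "{Inr 1}" "{Inr 2}" "\<lambda>h. h (Inr 1)" borel "\<lambda>h. h (Inr 2)" borel]
    by (simp add: Y.distr_X Plus_def image_iff)
  show ?thesis
    using indep_vars_distr_pair[OF joint_indep, of "{Inl 1}" "{Inr 1, Inr 2}" "\<lambda>h. h (Inl 1)" borel
        "\<lambda>h. (h (Inr 1), h (Inr 2))" "borel \<Otimes>\<^sub>M borel"] 1
    by (simp add: X.distr_X Plus_def image_iff)
qed

end

section \<open>Weak convergence\<close>

text \<open>The difference is at most 2, and at most \<bar>t\<bar> * \<bar>d\<bar> by the Lipschitz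
  estimate; the factor 2 + \<bar>t\<bar> covers both.\<close>

lemma cmod_iexp_diff_le: "cmod (iexp a - iexp b) \<le> (2 + \<bar>t\<bar>) * min 1 \<bar>d\<bar>" if "a - b = t * d"
proof -
  have "iexp a - iexp b = iexp b * (iexp (a - b) - 1)"
    by (simp add: algebra_simps flip: exp_add)
  then have "cmod (iexp a - iexp b) = cmod (iexp (a - b) - 1)"
    by (simp add: norm_mult)
  moreover have "cmod (iexp (a - b) - 1) \<le> \<bar>t\<bar> * \<bar>d\<bar>"
    using iexp_approx1[of "a - b" 0] that by (simp add: abs_mult)
  moreover have "cmod (iexp (a - b) - 1) \<le> 2"
    using norm_triangle_ineq4[of "iexp (a - b)" 1] by simp
  moreover have "0 \<le> \<bar>t\<bar> * \<bar>d\<bar>" "0 \<le> \<bar>d\<bar>" by auto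
  ultimately show ?thesis
    by (auto simp: min_def distrib_right)
qed

context prob_space begin

lemma char_distr: "U \<in> borel_measurable M \<Longrightarrow> char (distr M borel U) t = (CLINT \<omega>|M. iexp (t * U \<omega>))"
  unfolding char_def by (subst integral_distr) auto

lemma weak_conv_m_perturb:
  fixes U V :: "nat \<Rightarrow> 'a \<Rightarrow> real"
  assumes [measurable]: "\<And>n. U n \<in> borel_measurable M" "\<And>n. V n \<in> borel_measurable M"
    and diff: "(\<lambda>n. \<integral>\<omega>. min 1 \<bar>V n \<omega> - U n \<omega>\<bar> \<partial>M) \<longlonglongrightarrow> 0"
    and U: "weak_conv_m (\<lambda>n. distr M borel (U n)) L" and L: "real_distribution L"
  shows "weak_conv_m (\<lambda>n. distr M borel (V n)) L"
proof (rule levy_continuity[OF _ L])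
  fix t
  have i: "integrable M (\<lambda>\<omega>. iexp (t * Z \<omega>))" if [measurable]: "Z \<in> borel_measurable M" for Z :: "'a \<Rightarrow> real"
    by (rule integrable_const_bound[where B = 1]) auto
  have "(\<lambda>n. char (distr M borel (V n)) t - char (distr M borel (U n)) t) \<longlonglongrightarrow> 0"
  proof (rule Lim_null_comparison)
    show "(\<lambda>n. (2 + \<bar>t\<bar>) * (\<integral>\<omega>. min 1 \<bar>V n \<omega> - U n \<omega>\<bar> \<partial>M)) \<longlonglongrightarrow> 0"
      using tendsto_mult_right_zero[OF diff] .
    show "\<forall>\<^sub>F n in sequentially. cmod (char (distr M borel (V n)) t - char (distr M borel (U n)) t)
        \<le> (2 + \<bar>t\<bar>) * (\<integral>\<omega>. min 1 \<bar>V n \<omega> - U n \<omega>\<bar> \<partial>M)"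
    proof (intro always_eventually allI)
      fix n
      have "char (distr M borel (V n)) t - char (distr M borel (U n)) t =
          (CLINT \<omega>|M. iexp (t * V n \<omega>) - iexp (t * U n \<omega>))"
        by (subst Bochner_Integration.integral_diff[OF i i]) (auto simp: char_distr)
      also have "cmod \<dots> \<le> (\<integral>\<omega>. cmod (iexp (t * V n \<omega>) - iexp (t * U n \<omega>)) \<partial>M)"
        by (rule integral_norm_bound)
      also have "\<dots> \<le> (\<integral>\<omega>. (2 + \<bar>t\<bar>) * min 1 \<bar>V n \<omega> - U n \<omega>\<bar> \<partial>M)"
      proof (rule integral_mono)
        show "integrable M (\<lambda>\<omega>. cmod (iexp (t * V n \<omega>) - iexp (t * U n \<omega>)))"
          by (intro integrable_norm Bochner_Integration.integrable_diff i) auto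
        show "integrable M (\<lambda>\<omega>. (2 + \<bar>t\<bar>) * min 1 \<bar>V n \<omega> - U n \<omega>\<bar>)"
          by (intro integrable_mult_right integrable_const_bound[where B = 1]) auto
        show "cmod (iexp (t * V n \<omega>) - iexp (t * U n \<omega>)) \<le> (2 + \<bar>t\<bar>) * min 1 \<bar>V n \<omega> - U n \<omega>\<bar>" for \<omega>
          by (rule cmod_iexp_diff_le) (simp add: right_diff_distrib)
      qed
      finally show "cmod (char (distr M borel (V n)) t - char (distr M borel (U n)) t)
        \<le> (2 + \<bar>t\<bar>) * (\<integral>\<omega>. min 1 \<bar>V n \<omega> - U n \<omega>\<bar> \<partial>M)" by simp
    qed
  qed
  moreover have "(\<lambda>n. char (distr M borel (U n)) t) \<longlonglongrightarrow> char L t"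
    using L U by (intro levy_continuity1) auto
  ultimately have "(\<lambda>n. char (distr M borel (V n)) t - char (distr M borel (U n)) t + char (distr M borel (U n)) t)
      \<longlonglongrightarrow> 0 + char L t"
    by (rule tendsto_add)
  then show "(\<lambda>n. char (distr M borel (V n)) t) \<longlonglongrightarrow> char L t" by simp
qed auto

end

lemma normal_law_eq_distr:
  assumes "v > 0"
  shows "normal_law 0 v = distr std_normal_distribution borel (\<lambda>x. sqrt v * x)"
proof -
  interpret N: prob_space std_normal_distribution by (rule prob_space_normal_density) simp
  have "distributed std_normal_distribution lborel (\<lambda>x. x) (normal_density 0 1)"
    unfolding distributed_def by (auto intro!: distr_id2)
  from N.normal_density_affine[OF this, of "sqrt v" 0] assms
  have "distributed std_normal_distribution lborel (\<lambda>x. sqrt v * x) (normal_density 0 (sqrt v))"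
    by simp
  then show ?thesis
    using assms unfolding normal_law_def
    by (simp flip: distributed_distr_eq_density) (intro distr_cong, auto)
qed

lemma real_distribution_normal_law:
  assumes "v \<ge> 0" shows "real_distribution (normal_law 0 v)"
proof (cases "v = 0")
  case True
  then show ?thesis
    by (auto simp: normal_law_def real_distribution_def real_distribution_axioms_def intro: prob_space_return)
next
  case False
  interpret N: prob_space std_normal_distribution by (rule prob_space_normal_density) simp
  show ?thesis using False assms by (simp add: normal_law_eq_distr)
qed

lemma (in prob_space) central_limit_theorem_normal_law:
  fixes Z :: "nat \<Rightarrow> 'a \<Rightarrow> real"
  assumes indep: "indep_vars (\<lambda>_. borel) Z UNIV"
    and law: "\<And>i. distr M borel (Z i) = D"
    and mean: "\<And>i. expectation (Z i) = 0"
    and square: "\<And>i. integrable M (\<lambda>\<omega>. (Z i \<omega>)\<^sup>2)" "\<And>i. expectation (\<lambda>\<omega>. (Z i \<omega>)\<^sup>2) = v"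
  shows "weak_conv_m (\<lambda>n. distr M borel (\<lambda>\<omega>. (\<Sum>i<n. Z i \<omega>) / sqrt n)) (normal_law 0 v)"
proof -
  have [measurable]: "Z i \<in> borel_measurable M" for i
    using indep unfolding indep_vars_def2 by simp
  have "v \<ge> 0" using square(2)[of 0] by (metis integral_nonneg_AE zero_le_power2 AE_I2)
  then consider "v = 0" | "v > 0" by linarith
  then show ?thesis
  proof cases
    case 1
    have "AE \<omega> in M. \<forall>i. Z i \<omega> = 0"
      unfolding AE_all_countable
    proof
      fix i
      have "AE \<omega> in M. (Z i \<omega>)\<^sup>2 = 0"
        using integral_nonneg_eq_0_iff_AE[OF square(1)[of i]] square(2)[of i] 1 by simp
      then show "AE \<omega> in M. Z i \<omega> = 0" by simp
    qed
    then have "distr M borel (\<lambda>\<omega>. (\<Sum>i<n. Z i \<omega>) / sqrt n) = distr M borel (\<lambda>_. 0)" for n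
      by (intro distr_cong_AE) auto
    then show ?thesis using 1 by (simp add: normal_law_def weak_conv_m_def weak_conv_def distr_const)
  next
    case 2
    let ?S = "\<lambda>n \<omega>. (\<Sum>i<n. Z i \<omega>) / sqrt (n * (sqrt v)\<^sup>2)"
    have clt: "weak_conv_m (\<lambda>n. distr M borel (?S n)) std_normal_distribution"
      by (rule central_limit_theorem_zero_mean[OF indep mean _ square(1) _ law])
        (use 2 mean square in auto)
    interpret N: real_distribution std_normal_distribution by (rule real_dist_normal_dist)
    show ?thesis
    proof (rule levy_continuity)
      show "real_distribution (normal_law 0 v)" using 2 by (intro real_distribution_normal_law) simp
      fix t
      have "char (distr M borel (\<lambda>\<omega>. (\<Sum>i<n. Z i \<omega>) / sqrt n)) t = char (distr M borel (?S n)) (sqrt v * t)" for n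
        using 2 by (simp add: char_distr real_sqrt_mult mult.commute)
      moreover have "char (normal_law 0 v) t = char std_normal_distribution (sqrt v * t)"
        unfolding normal_law_eq_distr[OF 2] by (subst N.char_distr) (simp_all add: char_def mult_ac)
      moreover have "(\<lambda>n. char (distr M borel (?S n)) (sqrt v * t)) \<longlonglongrightarrow> char std_normal_distribution (sqrt v * t)"
        by (rule levy_continuity1[OF _ real_dist_normal_dist clt]) auto
      ultimately show "(\<lambda>n. char (distr M borel (\<lambda>\<omega>. (\<Sum>i<n. Z i \<omega>) / sqrt n)) t) \<longlonglongrightarrow> char (normal_law 0 v) t"
        by simp
    qed auto
  qed
qed

section \<open>The limit theorem\<close>

context product_kernel begin

lemma centered_section_mean:
  "integrable exp_law (\<lambda>x. (section_mean x - kernel_mean)\<^sup>2)"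
  "(\<integral>x. section_mean x - kernel_mean \<partial>exp_law) = 0"
proof -
  have "integrable exp_law (\<lambda>x. (section_mean x)\<^sup>2 - 2 * kernel_mean * section_mean x + kernel_mean\<^sup>2)"
    using integrable_section_mean integrable_section_mean_square by auto
  then show "integrable exp_law (\<lambda>x. (section_mean x - kernel_mean)\<^sup>2)"
    by (simp add: power2_eq_square algebra_simps)
  show "(\<integral>x. section_mean x - kernel_mean \<partial>exp_law) = 0"
    using integrable_section_mean exp_law.prob_space by (simp add: kernel_mean_def)
qed

lemma linear_score_moments:
  "integrable exp_law linear_score" "(\<integral>x. linear_score x \<partial>exp_law) = 0"
  "integrable exp_law (\<lambda>x. (linear_score x)\<^sup>2)"
  "(\<integral>x. (linear_score x)\<^sup>2 \<partial>exp_law) = (\<integral>x. (section_mean x - kernel_mean)\<^sup>2 \<partial>exp_law) - drift\<^sup>2"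
proof -
  note e = exp_law_centered_moments and a = centered_section_mean
  have ai: "integrable exp_law (\<lambda>x. section_mean x - kernel_mean)"
    using integrable_section_mean by auto
  have si: "integrable exp_law (\<lambda>x. section_mean x * (x - 1))"
    using integrable_section_mean_square e by (intro integrable_mult_of_squares) auto
  show "integrable exp_law linear_score" "(\<integral>x. linear_score x \<partial>exp_law) = 0"
    unfolding linear_score_def[abs_def] using ai a e by auto
  have cross: "integrable exp_law (\<lambda>x. (section_mean x - kernel_mean) * (x - 1))"
    "(\<integral>x. (section_mean x - kernel_mean) * (x - 1) \<partial>exp_law) = - drift"
  proof -
    have *: "(section_mean x - kernel_mean) * (x - 1) = section_mean x * (x - 1) - kernel_mean * (x - 1)" for x
      by (simp add: algebra_simps)
    show "integrable exp_law (\<lambda>x. (section_mean x - kernel_mean) * (x - 1))"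
      unfolding * by (intro Bochner_Integration.integrable_diff integrable_mult_right si e)
    show "(\<integral>x. (section_mean x - kernel_mean) * (x - 1) \<partial>exp_law) = - drift"
      unfolding * Bochner_Integration.integral_diff[OF si integrable_mult_right[OF e(1)]] integral_mult_right_zero e(2)
      by (simp add: section_mean_drift drift_def)
  qed
  have *: "(linear_score x)\<^sup>2 = (section_mean x - kernel_mean)\<^sup>2
      + 2 * drift * ((section_mean x - kernel_mean) * (x - 1)) + drift\<^sup>2 * (x - 1)\<^sup>2" for x
    by (simp add: linear_score_def power2_eq_square algebra_simps)
  show "integrable exp_law (\<lambda>x. (linear_score x)\<^sup>2)"
    unfolding * by (intro Bochner_Integration.integrable_add integrable_mult_right a cross e)
  show "(\<integral>x. (linear_score x)\<^sup>2 \<partial>exp_law) = (\<integral>x. (section_mean x - kernel_mean)\<^sup>2 \<partial>exp_law) - drift\<^sup>2"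
    unfolding * using a cross e by (simp add: power2_eq_square)
qed

end

locale two_sample_kernel = two_exponential_samples M X Y + product_kernel g
  for M :: "'a measure" and X Y :: "nat \<Rightarrow> 'a \<Rightarrow> real" and g :: "real \<Rightarrow> real"
begin

sublocale KX: sample_kernel M X g ..

sublocale KY: sample_kernel M Y g ..

definition pair_score :: "nat \<Rightarrow> 'a \<Rightarrow> real" where
  "pair_score i \<omega> = linear_score (X (Suc i) \<omega>) + linear_score (Y (Suc i) \<omega>)"

definition degenerate_sum :: "nat \<Rightarrow> 'a \<Rightarrow> real" where
  "degenerate_sum n \<omega> = (\<Sum>i=1..n. \<Sum>j=1..n. degenerate_part (normalized X n i \<omega>) (normalized Y n j \<omega>))"

lemma measurable_degenerate_part' [measurable (raw)]:
  "a \<in> borel_measurable N \<Longrightarrow> b \<in> borel_measurable N \<Longrightarrow> (\<lambda>z. degenerate_part (a z) (b z)) \<in> borel_measurable N"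
  using measurable_compose[OF measurable_Pair measurable_degenerate_part] by simp

lemma measurable_degenerate_sum [measurable]: "degenerate_sum n \<in> borel_measurable M"
  unfolding degenerate_sum_def[abs_def]
  by (intro borel_measurable_sum measurable_degenerate_part') auto

lemma measurable_pair_score [measurable]: "pair_score i \<in> borel_measurable M"
  unfolding pair_score_def[abs_def] by measurable

lemma scaled_double_sum_decomposition:
  assumes n: "n \<ge> 1"
  shows "(scaled_double_sum g X Y n \<omega> - (real n)\<^sup>2 * kernel_mean) / real n powr (3 / 2)
      - (\<Sum>i<n. pair_score i \<omega>) / sqrt n =
    degenerate_sum n \<omega> / (n * sqrt n) + (KX.linearization_error n \<omega> + KY.linearization_error n \<omega>)"
proof -
  have p: "real n powr (3 / 2) = n * sqrt n"
    using n powr_add[of "real n" 1 "1 / 2"] by (simp add: powr_half_sqrt)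
  have sn: "sqrt n > 0" "real n > 0" using n by auto
  define SX where "SX = (\<Sum>i=1..n. section_mean (normalized X n i \<omega>) - kernel_mean)"
  define SY where "SY = (\<Sum>j=1..n. section_mean (normalized Y n j \<omega>) - kernel_mean)"
  have "scaled_double_sum g X Y n \<omega> - (real n)\<^sup>2 * kernel_mean =
     (\<Sum>i=1..n. \<Sum>j=1..n. g (normalized X n i \<omega> * normalized Y n j \<omega>) - kernel_mean)"
    by (simp add: scaled_double_sum_def normalized_def sum_subtractf power2_eq_square)
  also have "\<dots> = (\<Sum>i=1..n. \<Sum>j=1..n. degenerate_part (normalized X n i \<omega>) (normalized Y n j \<omega>)
      + (section_mean (normalized X n i \<omega>) - kernel_mean) + (section_mean (normalized Y n j \<omega>) - kernel_mean))"
    by (simp add: degenerate_part_def algebra_simps)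
  also have "\<dots> = degenerate_sum n \<omega> + n * SX + n * SY"
    unfolding degenerate_sum_def SX_def SY_def sum.distrib by (simp add: sum_distrib_left)
  finally have 1: "scaled_double_sum g X Y n \<omega> - (real n)\<^sup>2 * kernel_mean = degenerate_sum n \<omega> + n * SX + n * SY" .
  have 2: "(\<Sum>i<n. pair_score i \<omega>) = (\<Sum>i=1..n. linear_score (X i \<omega>)) + (\<Sum>i=1..n. linear_score (Y i \<omega>))"
    unfolding pair_score_def sum.distrib
    by (simp add: sum.atLeast1_atMost_eq)
  show ?thesis
    unfolding 1 2 p KX.linearization_error_def KY.linearization_error_def SX_def[symmetric] SY_def[symmetric]
    using sn by (simp add: add_divide_distrib)
qed

lemma degenerate_sum_tendsto:
  "(\<lambda>n. \<integral>\<omega>. min 1 \<bar>degenerate_sum n \<omega> / (n * sqrt n)\<bar> \<partial>M) \<longlonglongrightarrow> 0"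
proof (rule tendsto_sandwich[where f = "\<lambda>_. 0"])
  define \<rho> where "\<rho> = (\<integral>z. (degenerate_part (fst z) (snd z))\<^sup>2 \<partial>(exp_law \<Otimes>\<^sub>M exp_law))"
  define C where "C = normalization_const"
  have \<rho>0: "0 \<le> \<rho>" unfolding \<rho>_def by simp
  have C0: "0 < C" unfolding C_def by (rule normalization_const_pos)
  have "(\<integral>\<^sup>+x. \<integral>\<^sup>+y. ennreal ((degenerate_part x y)\<^sup>2) \<partial>exp_law \<partial>exp_law) =
     (\<integral>\<^sup>+z. ennreal ((degenerate_part (fst z) (snd z))\<^sup>2) \<partial>(exp_law \<Otimes>\<^sub>M exp_law))"
    by (subst exp_law.nn_integral_fst[symmetric]) auto
  also have "\<dots> = ennreal \<rho>"
    unfolding \<rho>_def by (rule nn_integral_eq_integral[OF integrable_degenerate_part_square]) simp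
  finally have \<rho>: "(\<integral>\<^sup>+x. \<integral>\<^sup>+y. ennreal ((degenerate_part x y)\<^sup>2) \<partial>exp_law \<partial>exp_law) = ennreal \<rho>" .
  show "\<forall>\<^sub>F n in sequentially. (\<integral>\<omega>. min 1 \<bar>degenerate_sum n \<omega> / (n * sqrt n)\<bar> \<partial>M) \<le> (C\<^sup>2 * \<rho> + 1) / (2 * sqrt n)"
  proof (rule eventually_sequentiallyI[of 3])
    fix n :: nat assume n: "n \<ge> 3"
    have sn: "sqrt n > 0" "real n > 0" using n by auto
    have bound: "(\<integral>\<^sup>+\<omega>. ennreal ((degenerate_sum n \<omega>)\<^sup>2) \<partial>M) \<le> ennreal (C\<^sup>2 * n\<^sup>2 * \<rho>)"
    proof -
      have "(\<integral>\<^sup>+\<omega>. ennreal ((degenerate_sum n \<omega>)\<^sup>2) \<partial>M) \<le> ennreal (C * n) * (ennreal (C * n) * ennreal \<rho>)"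
        unfolding degenerate_sum_def \<rho>[symmetric] C_def
        by (rule nn_integral_degenerate_double_sum_le[OF n measurable_degenerate_part AE_degenerate_part])
           (use AE_degenerate_part in \<open>simp add: degenerate_part_commute[of _ "_ :: real"]\<close>)
      also have "\<dots> = ennreal (C\<^sup>2 * n\<^sup>2 * \<rho>)"
        using C0 \<rho>0 by (simp add: power2_eq_square ac_simps flip: ennreal_mult)
      finally show ?thesis .
    qed
    have int: "integrable M (\<lambda>\<omega>. (degenerate_sum n \<omega>)\<^sup>2)"
      using bound by (intro integrableI_bounded) (auto intro: le_less_trans)
    have le: "(\<integral>\<omega>. (degenerate_sum n \<omega>)\<^sup>2 \<partial>M) \<le> C\<^sup>2 * n\<^sup>2 * \<rho>"
      using bound \<rho>0 C0 by (subst (asm) nn_integral_eq_integral[OF int]) auto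
    have "(\<integral>\<omega>. min 1 \<bar>degenerate_sum n \<omega> / (n * sqrt n)\<bar> \<partial>M) \<le>
       (\<integral>\<omega>. ((degenerate_sum n \<omega>)\<^sup>2 / n\<^sup>2 + 1) / (2 * sqrt n) \<partial>M)"
    proof (rule integral_mono)
      show "integrable M (\<lambda>\<omega>. min 1 \<bar>degenerate_sum n \<omega> / (n * sqrt n)\<bar>)"
        by (rule integrable_const_bound[where B = 1]) auto
      show "integrable M (\<lambda>\<omega>. ((degenerate_sum n \<omega>)\<^sup>2 / n\<^sup>2 + 1) / (2 * sqrt n))"
        using int by auto
      fix \<omega>
      define d where "d = degenerate_sum n \<omega> / n"
      have "\<bar>degenerate_sum n \<omega> / (n * sqrt n)\<bar> = \<bar>d\<bar> / sqrt n"
        using sn by (simp add: d_def abs_divide)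
      also have "\<dots> \<le> ((d\<^sup>2 + 1) / 2) / sqrt n"
        using sum_squares_bound[of "\<bar>d\<bar>" 1] by (intro divide_right_mono) auto
      finally show "min 1 \<bar>degenerate_sum n \<omega> / (n * sqrt n)\<bar> \<le> ((degenerate_sum n \<omega>)\<^sup>2 / n\<^sup>2 + 1) / (2 * sqrt n)"
        by (simp add: d_def power_divide)
    qed
    also have "\<dots> = ((\<integral>\<omega>. (degenerate_sum n \<omega>)\<^sup>2 \<partial>M) / n\<^sup>2 + 1) / (2 * sqrt n)"
      using int prob_space by simp
    also have "\<dots> \<le> (C\<^sup>2 * \<rho> + 1) / (2 * sqrt n)"
      using le sn by (intro divide_right_mono add_right_mono) (auto simp: field_simps)
    finally show "(\<integral>\<omega>. min 1 \<bar>degenerate_sum n \<omega> / (n * sqrt n)\<bar> \<partial>M) \<le> (C\<^sup>2 * \<rho> + 1) / (2 * sqrt n)" .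
  qed
  show "(\<lambda>n. (C\<^sup>2 * \<rho> + 1) / (2 * sqrt (real n))) \<longlonglongrightarrow> 0"
    by (intro real_tendsto_divide_at_top[OF tendsto_const]
        filterlim_tendsto_pos_mult_at_top[OF tendsto_const _ filterlim_compose[OF sqrt_at_top filterlim_real_sequentially]]) simp
qed (auto intro!: always_eventually integral_nonneg_AE)

lemma pair_score_clt:
  "weak_conv_m (\<lambda>n. distr M borel (\<lambda>\<omega>. (\<Sum>i<n. pair_score i \<omega>) / sqrt n))
     (normal_law 0 (2 * (\<integral>x. (linear_score x)\<^sup>2 \<partial>exp_law)))"
proof (rule central_limit_theorem_normal_law)
  have "indep_vars (\<lambda>_. borel) (\<lambda>i \<omega>. (\<lambda>h. linear_score (h (Inl (Suc i))) + linear_score (h (Inr (Suc i))))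
      (\<lambda>k\<in>{Inl (Suc i), Inr (Suc i)}. case_sum X Y k \<omega>)) UNIV"
    by (rule indep_vars_compose2[OF indep_vars_restrict[OF joint_indep]]) (auto simp: disjoint_family_on_def)
  then show "indep_vars (\<lambda>_. borel) pair_score UNIV"
    by (simp add: pair_score_def[abs_def])
  note s = linear_score_moments
  let ?f = "\<lambda>z. linear_score (fst z) + linear_score (snd z)"
  fix i
  have law: "distr M (borel \<Otimes>\<^sub>M borel) (\<lambda>\<omega>. (X (Suc i) \<omega>, Y (Suc i) \<omega>)) = exp_law \<Otimes>\<^sub>M exp_law"
    by (rule distr_XY) auto
  have ps: "pair_score i = ?f \<circ> (\<lambda>\<omega>. (X (Suc i) \<omega>, Y (Suc i) \<omega>))"
    by (simp add: pair_score_def fun_eq_iff)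
  show "distr M borel (pair_score i) = distr (exp_law \<Otimes>\<^sub>M exp_law) borel ?f"
    unfolding law[symmetric] ps by (subst distr_distr) auto
  have mX: "expectation (\<lambda>\<omega>. h (X (Suc i) \<omega>)) = (\<integral>x. h x \<partial>exp_law)"
    and mY: "expectation (\<lambda>\<omega>. h (Y (Suc i) \<omega>)) = (\<integral>x. h x \<partial>exp_law)"
    if "h \<in> borel_measurable borel" for h :: "real \<Rightarrow> real"
    using that by (auto intro: X.integral_X Y.integral_X)
  have iX: "integrable M (\<lambda>\<omega>. h (X (Suc i) \<omega>))" and iY: "integrable M (\<lambda>\<omega>. h (Y (Suc i) \<omega>))"
    if "integrable exp_law h" for h :: "real \<Rightarrow> real"
    using that by (auto intro: X.integrable_X Y.integrable_X)
  show "expectation (pair_score i) = 0"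
    unfolding pair_score_def[abs_def] using s iX iY by (simp add: mX mY)
  have ss: "integrable (exp_law \<Otimes>\<^sub>M exp_law) (\<lambda>z. linear_score (fst z) * linear_score (snd z))"
    "(\<integral>z. linear_score (fst z) * linear_score (snd z) \<partial>(exp_law \<Otimes>\<^sub>M exp_law)) = 0"
    using exp_law2.integrable_product[OF s(1) s(1)] s(2) by auto
  have cross: "integrable M (\<lambda>\<omega>. linear_score (X (Suc i) \<omega>) * linear_score (Y (Suc i) \<omega>))"
    "expectation (\<lambda>\<omega>. linear_score (X (Suc i) \<omega>) * linear_score (Y (Suc i) \<omega>)) = 0"
    using ss unfolding law[symmetric] by (auto simp: integrable_distr_eq integral_distr)
  have sq: "(pair_score i \<omega>)\<^sup>2 = (linear_score (X (Suc i) \<omega>))\<^sup>2 + (linear_score (Y (Suc i) \<omega>))\<^sup>2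
     + 2 * (linear_score (X (Suc i) \<omega>) * linear_score (Y (Suc i) \<omega>))" for \<omega>
    by (simp add: pair_score_def power2_eq_square algebra_simps)
  show "integrable M (\<lambda>\<omega>. (pair_score i \<omega>)\<^sup>2)"
    unfolding sq using cross iX[OF s(3)] iY[OF s(3)] by auto
  show "expectation (\<lambda>\<omega>. (pair_score i \<omega>)\<^sup>2) = 2 * (\<integral>x. (linear_score x)\<^sup>2 \<partial>exp_law)"
    unfolding sq using cross iX[OF s(3)] iY[OF s(3)] mX[of "\<lambda>x. (linear_score x)\<^sup>2"] mY[of "\<lambda>x. (linear_score x)\<^sup>2"]
    by simp
qed

theorem scaled_double_sum_clt:
  "weak_conv_m
     (\<lambda>n. distr M borel
        (\<lambda>\<omega>. (scaled_double_sum g X Y n \<omega> - (real n)\<^sup>2 * kernel_mean) / real n powr (3 / 2)))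
     (normal_law 0 (2 * (\<integral>x. (linear_score x)\<^sup>2 \<partial>exp_law)))"
proof (rule weak_conv_m_perturb[OF _ _ _ pair_score_clt])
  show "(\<lambda>\<omega>. (scaled_double_sum g X Y n \<omega> - (real n)\<^sup>2 * kernel_mean) / real n powr (3 / 2)) \<in> borel_measurable M" for n
  proof -
    have [measurable]: "X i \<in> borel_measurable M" "Y i \<in> borel_measurable M" if "i \<in> {1..n}" for i
      using that by auto
    show ?thesis unfolding scaled_double_sum_def by measurable
  qed
  show "(\<lambda>\<omega>. (\<Sum>i<n. pair_score i \<omega>) / sqrt n) \<in> borel_measurable M" for n by measurable
  show "real_distribution (normal_law 0 (2 * (\<integral>x. (linear_score x)\<^sup>2 \<partial>exp_law)))"
    by (rule real_distribution_normal_law) simp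
  have "(\<lambda>n. \<integral>\<omega>. min 1 \<bar>degenerate_sum n \<omega> / (n * sqrt n) + (KX.linearization_error n \<omega> + KY.linearization_error n \<omega>)\<bar> \<partial>M)
      \<longlonglongrightarrow> 0"
    by (intro truncated_mean_add_tendsto degenerate_sum_tendsto KX.linearization_error_tendsto
        KY.linearization_error_tendsto) measurable
  then show "(\<lambda>n. \<integral>\<omega>. min 1 \<bar>(scaled_double_sum g X Y n \<omega> - (real n)\<^sup>2 * kernel_mean) / real n powr (3 / 2)
      - (\<Sum>i<n. pair_score i \<omega>) / sqrt n\<bar> \<partial>M) \<longlonglongrightarrow> 0"
    by (rule Lim_transform_eventually)
       (auto simp: scaled_double_sum_decomposition intro!: eventually_sequentiallyI[of 1])
qed

lemma expectation_kernel: "expectation (\<lambda>\<omega>. g (X 1 \<omega> * Y 1 \<omega>)) = kernel_mean"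
proof -
  have "expectation (\<lambda>\<omega>. g (X 1 \<omega> * Y 1 \<omega>)) =
     (\<integral>z. g (fst z * snd z) \<partial>distr M (borel \<Otimes>\<^sub>M borel) (\<lambda>\<omega>. (X 1 \<omega>, Y 1 \<omega>)))"
    by (subst integral_distr) auto
  then show ?thesis by (simp add: distr_XY kernel_mean_eq)
qed

lemma covariance_kernel_X: "covariance M (\<lambda>\<omega>. g (X 1 \<omega> * Y 1 \<omega>)) (X 1) = - drift"
proof -
  have ex: "expectation (X 1) = 1"
    by (rule trans[OF X.integral_X[of 1 "\<lambda>x. x"] exp_law_moments(2)]) simp_all
  have "covariance M (\<lambda>\<omega>. g (X 1 \<omega> * Y 1 \<omega>)) (X 1) =
     expectation (\<lambda>\<omega>. (g (X 1 \<omega> * Y 1 \<omega>) - kernel_mean) * (X 1 \<omega> - 1))"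
    unfolding covariance_def expectation_kernel ex ..
  also have "\<dots> = (\<integral>z. (g (fst z * snd z) - kernel_mean) * (fst z - 1)
      \<partial>distr M (borel \<Otimes>\<^sub>M borel) (\<lambda>\<omega>. (X 1 \<omega>, Y 1 \<omega>)))"
    by (subst integral_distr) auto
  also have "\<dots> = (\<integral>z. (g (fst z * snd z) - kernel_mean) * (fst z - 1) \<partial>(exp_law \<Otimes>\<^sub>M exp_law))"
    by (simp add: distr_XY)
  also have "\<dots> = (\<integral>x. \<integral>y. (g (x * y) - kernel_mean) * (x - 1) \<partial>exp_law \<partial>exp_law)"
  proof -
    have "integrable (exp_law \<Otimes>\<^sub>M exp_law) (\<lambda>z. (g (fst z * snd z) - kernel_mean) * (fst z - 1))"
    proof (rule integrable_mult_of_squares)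
      have "integrable (exp_law \<Otimes>\<^sub>M exp_law) (\<lambda>z. (g (fst z * snd z))\<^sup>2 - 2 * kernel_mean * g (fst z * snd z) + kernel_mean\<^sup>2)"
        using integrable_kernel_mult[of "\<lambda>_. 1"] square_integrable by auto
      then show "integrable (exp_law \<Otimes>\<^sub>M exp_law) (\<lambda>z. (g (fst z * snd z) - kernel_mean)\<^sup>2)"
        by (simp add: power2_eq_square algebra_simps)
      show "integrable (exp_law \<Otimes>\<^sub>M exp_law) (\<lambda>z. (fst z - 1)\<^sup>2)"
        using exp_law2.integrable_product(1)[OF exp_law_centered_moments(3), of "\<lambda>_. 1"] by simp
    qed auto
    from exp_law2.integral_fst'[OF this] show ?thesis by simp
  qed
  also have "\<dots> = (\<integral>x. section_mean x * (x - 1) - kernel_mean * (x - 1) \<partial>exp_law)"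
  proof (rule integral_cong_AE)
    show "AE x in exp_law. (\<integral>y. (g (x * y) - kernel_mean) * (x - 1) \<partial>exp_law) =
        section_mean x * (x - 1) - kernel_mean * (x - 1)"
      using AE_section_square_integrable
    proof eventually_elim
      case (elim x)
      then show ?case using integrable_section(1)[OF elim] exp_law.prob_space
        by (simp add: section_mean_def left_diff_distrib)
    qed
  qed auto
  also have "\<dots> = (\<integral>x. section_mean x * (x - 1) \<partial>exp_law) - kernel_mean * (\<integral>x. x - 1 \<partial>exp_law)"
    using integrable_section_mean_square exp_law_centered_moments
    by (subst Bochner_Integration.integral_diff) (auto intro: integrable_mult_of_squares)
  also have "\<dots> = - drift"
    by (simp add: section_mean_drift exp_law_centered_moments drift_def)
  finally show ?thesis .
qed

lemma covariance_kernel_shared_X: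
  "covariance M (\<lambda>\<omega>. g (X 1 \<omega> * Y 1 \<omega>)) (\<lambda>\<omega>. g (X 1 \<omega> * Y 2 \<omega>)) =
     (\<integral>x. (section_mean x - kernel_mean)\<^sup>2 \<partial>exp_law)"
proof -
  let ?k = "\<lambda>x y. g (x * y) - kernel_mean"
  have "integrable (exp_law \<Otimes>\<^sub>M exp_law) (\<lambda>z. (g (fst z * snd z))\<^sup>2 - 2 * kernel_mean * g (fst z * snd z) + kernel_mean\<^sup>2)"
    using integrable_kernel_mult[of "\<lambda>_. 1"] square_integrable by auto
  then have k2: "integrable (exp_law \<Otimes>\<^sub>M exp_law) (\<lambda>z. (?k (fst z) (snd z))\<^sup>2)"
    by (simp add: power2_eq_square algebra_simps)
  have kM: "integrable M (\<lambda>\<omega>. (?k (X 1 \<omega>) (Y j \<omega>))\<^sup>2)" if "j \<ge> 1" for j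
    using k2 that unfolding distr_XY[OF order_refl that, symmetric]
    by (subst (asm) integrable_distr_eq) auto
  have e2: "expectation (\<lambda>\<omega>. g (X 1 \<omega> * Y 2 \<omega>)) = kernel_mean"
  proof -
    have "expectation (\<lambda>\<omega>. g (X 1 \<omega> * Y 2 \<omega>)) =
       (\<integral>z. g (fst z * snd z) \<partial>distr M (borel \<Otimes>\<^sub>M borel) (\<lambda>\<omega>. (X 1 \<omega>, Y 2 \<omega>)))"
      by (subst integral_distr) auto
    then show ?thesis by (simp add: distr_XY kernel_mean_eq)
  qed
  interpret P3: pair_sigma_finite exp_law "exp_law \<Otimes>\<^sub>M exp_law" ..
  let ?F = "\<lambda>z. ?k (fst z) (fst (snd z)) * ?k (fst z) (snd (snd z))"
  have "integrable M (\<lambda>\<omega>. ?k (X 1 \<omega>) (Y 1 \<omega>) * ?k (X 1 \<omega>) (Y 2 \<omega>))"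
    using kM by (intro integrable_mult_of_squares) auto
  then have F: "integrable (exp_law \<Otimes>\<^sub>M (exp_law \<Otimes>\<^sub>M exp_law)) ?F"
    unfolding distr_XYY[symmetric] by (subst integrable_distr_eq) auto
  have "covariance M (\<lambda>\<omega>. g (X 1 \<omega> * Y 1 \<omega>)) (\<lambda>\<omega>. g (X 1 \<omega> * Y 2 \<omega>)) =
     expectation (\<lambda>\<omega>. ?k (X 1 \<omega>) (Y 1 \<omega>) * ?k (X 1 \<omega>) (Y 2 \<omega>))"
    unfolding covariance_def expectation_kernel e2 ..
  also have "\<dots> = (\<integral>z. ?F z \<partial>(exp_law \<Otimes>\<^sub>M (exp_law \<Otimes>\<^sub>M exp_law)))"
    unfolding distr_XYY[symmetric] by (subst integral_distr) auto
  also have "\<dots> = (\<integral>x. \<integral>w. ?k x (fst w) * ?k x (snd w) \<partial>(exp_law \<Otimes>\<^sub>M exp_law) \<partial>exp_law)"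
    using P3.integral_fst'[OF F] by simp
  also have "\<dots> = (\<integral>x. (section_mean x - kernel_mean)\<^sup>2 \<partial>exp_law)"
  proof (rule integral_cong_AE)
    show "AE x in exp_law. (\<integral>w. ?k x (fst w) * ?k x (snd w) \<partial>(exp_law \<Otimes>\<^sub>M exp_law)) = (section_mean x - kernel_mean)\<^sup>2"
      using AE_section_square_integrable
    proof eventually_elim
      case (elim x)
      have i: "integrable exp_law (?k x)" using integrable_section(1)[OF elim] by auto
      have "(\<integral>y. ?k x y \<partial>exp_law) = section_mean x - kernel_mean"
        using integrable_section(1)[OF elim] exp_law.prob_space by (simp add: section_mean_def)
      then show ?case using exp_law2.integrable_product(2)[OF i i] by (simp add: power2_eq_square)
    qed
    show "(\<lambda>x. \<integral>w. ?k x (fst w) * ?k x (snd w) \<partial>(exp_law \<Otimes>\<^sub>M exp_law)) \<in> borel_measurable exp_law"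
      using P3.integrable_fst'[OF F] by simp
  qed auto
  finally show ?thesis .
qed

end

theorem theorem1:
  fixes M :: "'a measure" and X Y :: "nat \<Rightarrow> 'a \<Rightarrow> real" and g :: "real \<Rightarrow> real"
    and \<mu> \<eta> c :: real
  assumes "prob_space M"
    and "prob_space.indep_vars M (\<lambda>_. borel) (case_sum X Y) ({1..} <+> {1..})"
    and "\<And>i. i \<ge> 1 \<Longrightarrow> distributed M lborel (X i) (exponential_density 1)"
    and "\<And>j. j \<ge> 1 \<Longrightarrow> distributed M lborel (Y j) (exponential_density 1)"
    and "g \<in> borel_measurable borel"
    and "continuous_on {0..} g"
    and "integrable M (\<lambda>\<omega>. (g (X 1 \<omega> * Y 1 \<omega>))\<^sup>2)"
    and "\<And>t0. t0 \<ge> 0 \<Longrightarrow>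
           \<exists>\<phi> \<in> borel_measurable borel.
             (\<forall>n\<ge>1. integrable M (\<lambda>\<omega>. \<phi> (sample_mean X n \<omega> * sample_mean Y n \<omega>) :: real)) \<and>
             (\<forall>t x. 0 \<le> t \<longrightarrow> t < t0 \<longrightarrow> 0 \<le> x \<longrightarrow> \<bar>g (t * x)\<bar> < \<phi> x)"
    and "\<And>t0. t0 \<ge> 0 \<Longrightarrow>
           \<exists>\<psi> \<in> borel_measurable borel.
             (\<forall>n\<ge>1. integrable M (\<lambda>\<omega>. \<psi> (sample_mean X n \<omega> * sample_mean Y n \<omega>) :: real)) \<and>
             (\<forall>t x. t > t0 \<longrightarrow> 0 \<le> x \<longrightarrow> g t \<noteq> 0 \<and> \<bar>g (t * x) / g t\<bar> < \<psi> x)"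
    and "\<mu> = (\<integral>\<omega>. g (X 1 \<omega> * Y 1 \<omega>) \<partial>M)"
    and "\<eta> = covariance M (\<lambda>\<omega>. g (X 1 \<omega> * Y 1 \<omega>)) (\<lambda>\<omega>. g (X 1 \<omega> * Y 2 \<omega>))"
    and "c = covariance M (\<lambda>\<omega>. g (X 1 \<omega> * Y 1 \<omega>)) (X 1)"
  shows "weak_conv_m
           (\<lambda>n. distr M borel
              (\<lambda>\<omega>. (scaled_double_sum g X Y n \<omega> - (real n)\<^sup>2 * \<mu>) / real n powr (3 / 2)))
           (normal_law 0 (2 * (\<eta> - c\<^sup>2)))"
proof -
  interpret two_exponential_samples M X Y
    using assms(1-4) unfolding two_exponential_samples_def two_exponential_samples_axioms_def by blast
  interpret two_sample_kernel M X Y g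
  proof unfold_locales
    have "integrable (distr M (borel \<Otimes>\<^sub>M borel) (\<lambda>\<omega>. (X 1 \<omega>, Y 1 \<omega>))) (\<lambda>z. (g (fst z * snd z))\<^sup>2)"
      using assms(5,7) by (subst integrable_distr_eq) auto
    then show "integrable (exp_law \<Otimes>\<^sub>M exp_law) (\<lambda>z. (g (fst z * snd z))\<^sup>2)"
      by (simp add: distr_XY)
  qed (rule assms(5))
  have "\<mu> = kernel_mean"
    unfolding assms(10) by (rule expectation_kernel)
  moreover have "\<eta> - c\<^sup>2 = (\<integral>x. (linear_score x)\<^sup>2 \<partial>exp_law)"
    unfolding assms(11,12) covariance_kernel_X covariance_kernel_shared_X linear_score_moments(4) by simp
  ultimately show ?thesis
    using scaled_double_sum_clt by simp
qed

end
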